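(* For each integer $k \ge 4$ with $k\neq 5$ there is a positive constant $c_k$ such that the following holds. Let $k,\ell$ be fixed integers with $4 \leq k$, $k \neq 5$, $2 \leq \ell$ and $\ell \neq k$, and let $n$ be an integer with $k\le 2^n$ and $\ell \le 2^n$. Then, as $n\to\infty$, \[ \binom{n}{\ell}^{-1} \frac{2^{\ell-\lceil\log_2(2 \ell)\rceil}}{z_{\ell, \ell}} (1 - o(1)) \leq \mathbf{d}(Q_n, C_{2 \ell}, C_{2k}) \leq c_k\, n^{-\frac{1}{16}} . \]
   Context: $Q_n$ denotes the $n$-dimensional hypercube: its vertices are the binary vectors of length $n$, two vectors being adjacent iff they differ in exactly one coordinate (the flip coordinate of the edge). $C_m$ is the cycle on $m$ vertices. For graphs $G$ and $T$, a copy of $T$ in $G$ is a subgraph of $G$ isomorphic to $T$, and $N(G,T)$ is the number of copies of $T$ in $G$. A graph is $H$-free if it has no subgraph isomorphic to $H$. For subgraphs $T,H$ of $G$, $\mathrm{ex}(G,T,H)=\max\{N(G',T): G'\subseteq G,\ G' \text{ is } H\text{-free}\}$ and $\mathbf{d}(G,T,H)=\mathrm{ex}(G,T,H)/N(G,T)$. For integers $k,\ell$, $z_{k,\ell}$ denotes the number of copies of $C_{2\ell}$ in $Q_k$ whose edges together use all $k$ coordinates as flip coordinates. The term $o(1)$ denotes a nonnegative quantity tending to $0$ as $n\to\infty$ with $k,\ell$ fixed. *)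

theory Defs
  imports Complex_Main
begin

type_synonym 'a graph = "'a set \<times> 'a set set"

abbreviation verts :: "'a graph \<Rightarrow> 'a set" where
  "verts G \<equiv> fst G"

abbreviation edges :: "'a graph \<Rightarrow> 'a set set" where
  "edges G \<equiv> snd G"

definition simple_graph :: "'a graph \<Rightarrow> bool" where
  "simple_graph G \<longleftrightarrow>
     (\<forall>e\<in>edges G. \<exists>u v. u \<in> verts G \<and> v \<in> verts G \<and> u \<noteq> v \<and> e = {u, v})"

text \<open>Subgraphs are arbitrary: neither spanning nor induced.\<close>

definition subgraph :: "'a graph \<Rightarrow> 'a graph \<Rightarrow> bool" where
  "subgraph H G \<longleftrightarrow> simple_graph H \<and> verts H \<subseteq> verts G \<and> edges H \<subseteq> edges G"

definition isomorphic :: "'a graph \<Rightarrow> 'b graph \<Rightarrow> bool" where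
  "isomorphic G H \<longleftrightarrow>
     (\<exists>f. bij_betw f (verts G) (verts H) \<and>
          (\<forall>u\<in>verts G. \<forall>v\<in>verts G. {u, v} \<in> edges G \<longleftrightarrow> {f u, f v} \<in> edges H))"

definition copies :: "'a graph \<Rightarrow> 'b graph \<Rightarrow> 'a graph set" where
  "copies G T = {S. subgraph S G \<and> isomorphic S T}"

definition num_copies :: "'a graph \<Rightarrow> 'b graph \<Rightarrow> nat" where
  "num_copies G T = card (copies G T)"

definition is_free :: "'b graph \<Rightarrow> 'a graph \<Rightarrow> bool" where
  "is_free H G \<longleftrightarrow> copies G H = {}"

text \<open>The maximum is over a finite nonempty set whenever \<open>G\<close> is finite and \<open>H\<close> has a vertex.\<close>

definition gen_turan :: "'a graph \<Rightarrow> 'b graph \<Rightarrow> 'c graph \<Rightarrow> nat" where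
  "gen_turan G T H = Max {num_copies G' T | G'. subgraph G' G \<and> is_free H G'}"

text \<open>By the convention \<open>x / 0 = 0\<close> the value is 0 if \<open>G\<close> has no copy of \<open>T\<close>.\<close>

definition turan_ratio :: "'a graph \<Rightarrow> 'b graph \<Rightarrow> 'c graph \<Rightarrow> real" where
  "turan_ratio G T H = real (gen_turan G T H) / real (num_copies G T)"

definition hypercube :: "nat \<Rightarrow> bool list graph" where
  "hypercube n =
     ({x. length x = n},
      {{x, y} | x y. length x = n \<and> length y = n \<and> (\<exists>!i. i < n \<and> x ! i \<noteq> y ! i)})"

text \<open>Meaningful only for edges of a hypercube; coordinates are numbered from 0.\<close>

definition flip_coord :: "bool list set \<Rightarrow> nat" where
  "flip_coord e = (THE i. \<exists>x\<in>e. \<exists>y\<in>e. i < length x \<and> x ! i \<noteq> y ! i)"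

text \<open>A cycle on \<open>m\<close> vertices for \<open>m \<ge> 3\<close>; smaller values do not occur below.\<close>

definition cycle_graph :: "nat \<Rightarrow> nat graph" where
  "cycle_graph m = ({..<m}, {{i, (i + 1) mod m} | i. i < m})"

definition full_cycles :: "nat \<Rightarrow> nat \<Rightarrow> nat" where
  "full_cycles k l =
     card {C \<in> copies (hypercube k) (cycle_graph (2 * l)). flip_coord ` edges C = {..<k}}"

end

(*
  Since Q_n is edge-transitive, double counting pairs (copy, edge) bounds the density of C_2l in a
  subgraph by its edge density, so the upper bound reduces to showing that a C_2k-free subgraph G
  has edge density O(n^(-1/12)).  View vertices as subsets of {..<n}.  If G is dense, convexity of
  d(d-1)(d-2) gives a base S with many triples c, x, y such that all three edges going down from
  S + {c,x,y} lie in G.  By Cauchy-Schwarz, two elements c, c' share many pairs (x, y); these pairs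
  form a graph with at least C n^(3/2) edges, which by dependent random choice contains a cycle of
  any prescribed even length 2s >= 4 with a pendant edge.  The cycle alone lifts to a C_4s in G
  (all triples containing c), and together with the pendant edge and both of c, c' to a C_(4s+6).
  These lengths cover 2k for all k >= 4 except k = 5.

  For the lower bound, Q_n splits into subcubes of dimension ceil(log2 (2l)), each of which contains
  a C_2l; the union of these disjoint cycles has no C_2k.  Each flip coordinate of a cycle occurs at
  least twice, so C_2l uses at most l coordinates, and up to lower order terms the copies of C_2l in
  Q_n are the z_{l,l} copies in each of the (n choose l) 2^(n-l) subcubes of dimension l.
*)

theory Submission
  imports Defs
begin

section \<open>Cycles as subgraphs\<close>

text \<open>For a fixed c, the sets S + {c,x} and S + {c,x,y} span in G a subdivision of the graph
  of pairs (x, y), so c alone only doubles cycle lengths of that graph. As a dense graph may be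
  bipartite, this guarantees multiples of 4 only; every other length requires a change of c. An
  exchange takes two edges, from S + {c,x,y} through S + {x,y} to S + {c',x,y}, at an edge of the
  pair graph. With two exchanges, a closed walk of p steps in the line graph of the pair graph gives
  length 2p + 4, so p has to be odd. The line graph of an even cycle is bipartite; the pendant edge
  supplies the missing odd cycle, since three edges now meet at its foot. The walk used has 2s - 1
  steps with c and 2 steps with c', hence 2(2s + 1) + 4 = 4s + 6. The exponent: average down-degree
  x gives about x^3 triples at some base, hence two elements sharing about x^6 / n^4 pairs. This
  reaches n^(3/2) at x = n^(11/12), that is, at density n^(-1/12), which is below the claimed
  n^(-1/16).\<close>

definition cyc :: "(nat \<Rightarrow> 'a) \<Rightarrow> nat \<Rightarrow> 'a graph" where
  "cyc f m = (f ` {..<m}, (\<lambda>i. {f i, f (Suc i mod m)}) ` {..<m})"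

lemma Suc_mod_less: "i < m \<Longrightarrow> Suc i mod m < m"
  by (simp add: mod_less_divisor)

lemma Suc_mod_neq: "i < m \<Longrightarrow> m \<ge> 2 \<Longrightarrow> Suc i mod m \<noteq> i"
  by (cases "Suc i = m") auto

text \<open>Equal edges with different indices would be traversed in opposite directions, which
  makes i and j successors of each other modulo m; this forces m \<le> 2.\<close>

lemma cyc_step_inj:
  assumes "inj_on f {..<m}" "m \<ge> 3" "i < m" "j < m"
    and eq: "{f i, f (Suc i mod m)} = {f j, f (Suc j mod m)}"
  shows "i = j"
proof (rule ccontr)
  assume ne: "i \<noteq> j"
  have "f i \<noteq> f j" using assms ne by (auto dest: inj_onD)
  then have "f i = f (Suc j mod m)" "f (Suc i mod m) = f j" using eq by (auto simp: doubleton_eq_iff)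
  then have "i = Suc j mod m" "Suc i mod m = j"
    using assms(1-4) Suc_mod_less[of i m] Suc_mod_less[of j m]
    by (auto dest: inj_onD[where x = i] inj_onD[where x = "Suc i mod m"])
  then show False using assms(2-4)
    by (cases "Suc i = m"; cases "Suc j = m") auto
qed

lemma card_edges_cyc:
  assumes "inj_on f {..<m}" "m \<ge> 3"
  shows "card (edges (cyc f m)) = m"
proof -
  have "inj_on (\<lambda>i. {f i, f (Suc i mod m)}) {..<m}"
    using cyc_step_inj[OF assms] by (intro inj_onI) auto
  then show ?thesis by (simp add: cyc_def card_image)
qed

lemma simple_graph_edge_verts: "simple_graph G \<Longrightarrow> e \<in> edges G \<Longrightarrow> e \<subseteq> verts G"
  unfolding simple_graph_def by fastforce

text \<open>Chords of the cycle in G do no harm: \<open>isomorphic\<close> looks only at the edges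
  of \<open>cyc f m\<close> itself.\<close>

lemma cyc_in_copies:
  assumes inj: "inj_on f {..<m}" and m: "m \<ge> 3" and simp: "simple_graph G"
    and E: "\<And>i. i < m \<Longrightarrow> {f i, f (Suc i mod m)} \<in> edges G"
  shows "cyc f m \<in> copies G (cycle_graph m)"
proof -
  have sub: "subgraph (cyc f m) G"
    unfolding subgraph_def simple_graph_def
  proof (intro conjI ballI)
    fix e assume "e \<in> edges (cyc f m)"
    then obtain i where i: "i < m" "e = {f i, f (Suc i mod m)}" by (auto simp: cyc_def)
    have "f i \<noteq> f (Suc i mod m)"
      using inj_onD[OF inj, of i "Suc i mod m"] Suc_mod_neq[of i m] Suc_mod_less[of i m] i m by auto
    then show "\<exists>u v. u \<in> verts (cyc f m) \<and> v \<in> verts (cyc f m) \<and> u \<noteq> v \<and> e = {u, v}"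
      using i Suc_mod_less[OF i(1)]
      by (intro exI[of _ "f i"] exI[of _ "f (Suc i mod m)"]) (auto simp: cyc_def)
  next
    have "f i \<in> verts G" if "i < m" for i
      using simple_graph_edge_verts[OF simp E[OF that]] by simp
    then show "verts (cyc f m) \<subseteq> verts G" by (auto simp: cyc_def)
  qed (use E in \<open>auto simp: cyc_def\<close>)
  let ?g = "inv_into {..<m} f"
  have g: "?g (f i) = i" if "i < m" for i using inj that by simp
  have "isomorphic (cyc f m) (cycle_graph m)"
    unfolding isomorphic_def
  proof (intro exI[of _ ?g] conjI ballI)
    show "bij_betw ?g (verts (cyc f m)) (verts (cycle_graph m))"
      using inj by (auto simp: cyc_def cycle_graph_def intro!: bij_betw_inv_into inj_on_imp_bij_betw)
  next
    fix u v assume "u \<in> verts (cyc f m)" "v \<in> verts (cyc f m)"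
    then obtain i j where ij: "u = f i" "v = f j" "i < m" "j < m" by (auto simp: cyc_def)
    have "({f i, f j} \<in> edges (cyc f m)) \<longleftrightarrow> (\<exists>p<m. {f i, f j} = f ` {p, Suc p mod m})"
      by (auto simp: cyc_def)
    also have "\<dots> \<longleftrightarrow> (\<exists>p<m. f ` {i, j} = f ` {p, Suc p mod m})" by simp
    also have "\<dots> \<longleftrightarrow> (\<exists>p<m. {i, j} = {p, Suc p mod m})"
    proof -
      have "f ` {i, j} = f ` {p, Suc p mod m} \<longleftrightarrow> {i, j} = {p, Suc p mod m}" if "p < m" for p
        by (rule inj_on_image_eq_iff[OF inj]) (use ij that Suc_mod_less in auto)
      then show ?thesis by blast
    qed
    finally show "({u, v} \<in> edges (cyc f m)) = ({?g u, ?g v} \<in> edges (cycle_graph m))"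
      using ij g by (auto simp: cycle_graph_def)
  qed
  with sub show ?thesis by (simp add: copies_def)
qed

text \<open>The parametrisation is the inverse of the isomorphism. A subgraph is simple by
  definition, so each of its edges is a pair of its vertices and is seen by the isomorphism.\<close>

lemma copies_cycleE:
  assumes S: "S \<in> copies G (cycle_graph m)"
  obtains f where "inj_on f {..<m}" "S = cyc f m"
    "\<forall>i<m. f i \<in> verts G \<and> {f i, f (Suc i mod m)} \<in> edges G"
proof -
  from S obtain g where sub: "subgraph S G" and bij: "bij_betw g (verts S) {..<m}"
    and E: "\<And>u v. u \<in> verts S \<Longrightarrow> v \<in> verts S \<Longrightarrow> {u, v} \<in> edges S \<longleftrightarrow> {g u, g v} \<in> edges (cycle_graph m)"
    by (auto simp: copies_def isomorphic_def cycle_graph_def)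
  define f where "f = inv_into (verts S) g"
  have bf: "bij_betw f {..<m} (verts S)" unfolding f_def using bij by (rule bij_betw_inv_into)
  have gf: "g (f i) = i" if "i < m" for i
    using bij that by (simp add: f_def bij_betw_inv_into_right)
  have fg: "f (g u) = u" if "u \<in> verts S" for u
    using bij that by (simp add: f_def bij_betw_inv_into_left)
  have fV: "f i \<in> verts S" if "i < m" for i using bf that by (auto simp: bij_betw_def)
  have step: "{f i, f (Suc i mod m)} \<in> edges S" if "i < m" for i
    using E[of "f i" "f (Suc i mod m)"] fV that Suc_mod_less[OF that] gf
    by (auto simp: cycle_graph_def)
  have "edges S = (\<lambda>i. {f i, f (Suc i mod m)}) ` {..<m}"
  proof (intro equalityI subsetI)
    fix e assume e: "e \<in> edges S"
    then obtain u v where uv: "u \<in> verts S" "v \<in> verts S" "e = {u, v}"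
      using sub unfolding subgraph_def simple_graph_def by blast
    with E e obtain i where i: "i < m" "{g u, g v} = {i, Suc i mod m}"
      by (auto simp: cycle_graph_def)
    have "e = f ` {g u, g v}" using uv fg by simp
    also have "\<dots> = {f i, f (Suc i mod m)}" by (simp add: i(2))
    finally show "e \<in> (\<lambda>i. {f i, f (Suc i mod m)}) ` {..<m}" using i(1) by auto
  qed (use step in auto)
  moreover have "verts S = f ` {..<m}" using bf by (simp add: bij_betw_def)
  ultimately have "S = cyc f m" unfolding cyc_def by (metis prod.collapse)
  moreover have "inj_on f {..<m}" using bf by (simp add: bij_betw_def)
  ultimately show thesis
    using that fV step sub by (simp add: subgraph_def subset_eq)
qed

lemma cyc_nth_in_copies:
  assumes d: "distinct xs" and len: "length xs \<ge> 3"
    and simp: "simple_graph G"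
    and E: "successively (\<lambda>x y. {x, y} \<in> edges G) xs" "{last xs, hd xs} \<in> edges G"
  shows "cyc ((!) xs) (length xs) \<in> copies G (cycle_graph (length xs))"
proof (rule cyc_in_copies)
  show "inj_on ((!) xs) {..<length xs}" using d by (simp add: inj_on_nth)
  fix i assume i: "i < length xs"
  show "{xs ! i, xs ! (Suc i mod length xs)} \<in> edges G"
  proof (cases "Suc i = length xs")
    case True
    then have "xs \<noteq> []" "i = length xs - 1" "Suc i mod length xs = 0"
      by auto
    then have "xs ! i = last xs" "xs ! (Suc i mod length xs) = hd xs"
      by (simp_all add: last_conv_nth hd_conv_nth)
    then show ?thesis using E(2) by simp
  next
    case False
    then show ?thesis using E(1) i by (simp add: successively_conv_nth)
  qed
qed (use simp len in auto)

section \<open>Finiteness of copies and the extremal number\<close>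

lemma simple_subgraph_finite_copies:
  assumes "finite (verts G)" "finite (edges G)"
  shows "finite {H. subgraph H G}"
proof (rule finite_subset)
  show "{H. subgraph H G} \<subseteq> Pow (verts G) \<times> Pow (edges G)"
    by (auto simp: subgraph_def)
qed (use assms in auto)

lemma finite_copies:
  assumes "finite (verts G)" "finite (edges G)"
  shows "finite (copies G T)"
  by (rule finite_subset[OF _ simple_subgraph_finite_copies[OF assms]]) (auto simp: copies_def)

lemma copies_mono: "subgraph G' G \<Longrightarrow> copies G' T \<subseteq> copies G T"
  by (auto simp: copies_def subgraph_def)

lemma num_copies_le_gen_turan:
  assumes "finite (verts G)" "finite (edges G)" "subgraph G' G" "is_free H G'"
  shows "num_copies G' T \<le> gen_turan G T H"
proof -
  have "finite {num_copies G' T | G'. subgraph G' G \<and> is_free H G'}"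
    by (rule finite_subset[OF _ finite_imageI[OF simple_subgraph_finite_copies[OF assms(1,2)]]]) auto
  then show ?thesis unfolding gen_turan_def using assms(3,4) by (intro Max_ge) blast+
qed

lemma gen_turan_attained:
  assumes "finite (verts G)" "finite (edges G)" "m > 0"
  obtains G' where "subgraph G' G" "is_free (cycle_graph m) G'" "gen_turan G T (cycle_graph m) = num_copies G' T"
proof -
  have fin: "finite {num_copies G' T | G'. subgraph G' G \<and> is_free (cycle_graph m) G'}"
    by (rule finite_subset[OF _ finite_imageI[OF simple_subgraph_finite_copies[OF assms(1,2)]]]) auto
  \<comment> \<open>The empty graph makes the set of values nonempty, so that \<open>Max\<close> is
    attained.\<close>
  have "subgraph ({}, {}) G" by (simp add: subgraph_def simple_graph_def)
  moreover have "is_free (cycle_graph m) (({}, {}) :: 'a graph)"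
    unfolding is_free_def
  proof (intro equals0I)
    fix S :: "'a graph" assume "S \<in> copies ({}, {}) (cycle_graph m)"
    then obtain f where "\<forall>i<m. f i \<in> verts (({}, {}) :: 'a graph) \<and>
        {f i, f (Suc i mod m)} \<in> edges (({}, {}) :: 'a graph)"
      by (rule copies_cycleE)
    then show False using assms(3) by simp
  qed
  ultimately have "{num_copies G' T | G'. subgraph G' G \<and> is_free (cycle_graph m) G'} \<noteq> {}" by blast
  from Max_in[OF fin this] show thesis
    using that unfolding gen_turan_def by blast
qed

text \<open>By transitivity every edge of \<open>G\<close> lies in the same number of copies.\<close>

lemma edge_transitive_cycle_density:
  assumes fin: "finite (verts G)" "finite (edges G)" and m: "m \<ge> 3" and sub: "subgraph G' G"
    and trans: "\<And>e e'. e \<in> edges G \<Longrightarrow> e' \<in> edges G \<Longrightarrow>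
      \<exists>\<phi>. inj_on \<phi> (verts G) \<and> \<phi> ` verts G \<subseteq> verts G \<and> (\<forall>a\<in>edges G. \<phi> ` a \<in> edges G) \<and> \<phi> ` e = e'"
    and simp: "simple_graph G"
  shows "num_copies G' (cycle_graph m) * card (edges G) \<le> card (edges G') * num_copies G (cycle_graph m)"
proof (cases "edges G = {}")
  case False
  let ?T = "cycle_graph m"
  define D where "D e = card {C \<in> copies G ?T. e \<in> edges C}" for e
  have finC: "finite (copies G ?T)" using fin by (rule finite_copies)
  have finE': "finite (edges G')" using fin sub by (auto simp: subgraph_def intro: finite_subset)
  have eV: "e \<subseteq> verts G" if "e \<in> edges G" for e
    using simp that by (rule simple_graph_edge_verts)
  \<comment> \<open>Pushing copies forward along \<phi> gives only an inequality; exchanging the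
    roles of e and e' yields \<open>D_eq\<close> without constructing an inverse of \<phi>.\<close>
  have D_le: "D e \<le> D e'" if e: "e \<in> edges G" "e' \<in> edges G" for e e'
  proof -
    from trans[OF e] obtain \<phi> where \<phi>: "inj_on \<phi> (verts G)" "\<phi> ` verts G \<subseteq> verts G"
      "\<And>a. a \<in> edges G \<Longrightarrow> \<phi> ` a \<in> edges G" "\<phi> ` e = e'" by blast
    define \<Phi> where "\<Phi> C = (\<phi> ` verts C, (`) \<phi> ` edges C)" for C :: "'a graph"
    have inj1: "inj_on ((`) \<phi>) (Pow (verts G))" using \<phi>(1) by (rule inj_on_image_Pow)
    have inj2: "inj_on ((`) ((`) \<phi>)) (Pow (Pow (verts G)))" using inj1 by (rule inj_on_image_Pow)
    have inj: "inj_on \<Phi> (copies G ?T)"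
    proof (rule inj_onI)
      fix C C' assume C: "C \<in> copies G ?T" "C' \<in> copies G ?T" "\<Phi> C = \<Phi> C'"
      have "verts C \<subseteq> verts G" "verts C' \<subseteq> verts G" "edges C \<subseteq> Pow (verts G)" "edges C' \<subseteq> Pow (verts G)"
        using C(1,2) eV unfolding copies_def subgraph_def by blast+
      then have "verts C = verts C'" "edges C = edges C'"
        using C(3) inj_onD[OF inj1, of "verts C" "verts C'"] inj_onD[OF inj2, of "edges C" "edges C'"]
        by (auto simp: \<Phi>_def)
      then show "C = C'" by (simp add: prod_eq_iff)
    qed
    have "\<Phi> C \<in> {C \<in> copies G ?T. e' \<in> edges C}" if C: "C \<in> copies G ?T" "e \<in> edges C" for C
    proof -
      from C(1) obtain f where f: "inj_on f {..<m}" "C = cyc f m"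
        "\<forall>i<m. f i \<in> verts G \<and> {f i, f (Suc i mod m)} \<in> edges G"
        by (rule copies_cycleE)
      have eq: "\<Phi> C = cyc (\<phi> \<circ> f) m" by (auto simp: \<Phi>_def f(2) cyc_def image_image)
      have "cyc (\<phi> \<circ> f) m \<in> copies G ?T"
      proof (rule cyc_in_copies)
        show "inj_on (\<phi> \<circ> f) {..<m}"
          using f(1,3) \<phi>(1) by (intro comp_inj_on) (auto intro: inj_on_subset)
        show "{(\<phi> \<circ> f) i, (\<phi> \<circ> f) (Suc i mod m)} \<in> edges G" if "i < m" for i
          using \<phi>(3)[of "{f i, f (Suc i mod m)}"] f(3) that by simp
      qed (use m simp in auto)
      moreover have "e' \<in> edges (\<Phi> C)" using C(2) \<phi>(4) by (auto simp: \<Phi>_def)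
      ultimately show ?thesis using eq by simp
    qed
    then have "\<Phi> ` {C \<in> copies G ?T. e \<in> edges C} \<subseteq> {C \<in> copies G ?T. e' \<in> edges C}" by blast
    then show ?thesis unfolding D_def
      by (intro card_inj_on_le[of \<Phi>]) (use inj finC in \<open>auto intro: inj_on_subset\<close>)
  qed
  from False obtain e0 where e0: "e0 \<in> edges G" by blast
  have D_eq: "D e = D e0" if "e \<in> edges G" for e using D_le e0 that by (simp add: order_antisym)
  \<comment> \<open>Double counting for a family A of copies, to be applied both to all copies in G
    and to those in G'.\<close>
  have count: "(\<Sum>e\<in>E. card {C \<in> A. e \<in> edges C}) = m * card A"
    if A: "A \<subseteq> copies G ?T" and E: "finite E" "\<And>C. C \<in> A \<Longrightarrow> edges C \<subseteq> E" for A E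
  proof -
    have finA: "finite A" using A finC by (rule finite_subset)
    have "(\<Sum>e\<in>E. card {C \<in> A. e \<in> edges C}) = (\<Sum>C\<in>A. card {e \<in> E. e \<in> edges C})"
      using sum.swap_restrict[OF E(1) finA, of "\<lambda>_ _. 1::nat" "\<lambda>e C. e \<in> edges C"] by simp
    also have "\<dots> = (\<Sum>C\<in>A. m)"
    proof (rule sum.cong[OF refl])
      fix C assume C: "C \<in> A"
      then have "{e \<in> E. e \<in> edges C} = edges C" using E by blast
      moreover have "card (edges C) = m"
      proof -
        have "C \<in> copies G ?T" using C A by blast
        then obtain f where "inj_on f {..<m}" "C = cyc f m" by (rule copies_cycleE)
        then show ?thesis using card_edges_cyc m by simp
      qed
      ultimately show "card {e \<in> E. e \<in> edges C} = m" by simp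
    qed
    finally show ?thesis by simp
  qed
  have "m * num_copies G ?T = (\<Sum>e\<in>edges G. D e)"
    unfolding num_copies_def D_def
    by (rule count[symmetric]) (use fin in \<open>auto simp: copies_def subgraph_def\<close>)
  also have "\<dots> = card (edges G) * D e0" using D_eq by simp
  finally have 1: "m * num_copies G ?T = card (edges G) * D e0" .
  have "m * num_copies G' ?T = (\<Sum>e\<in>edges G'. card {C \<in> copies G' ?T. e \<in> edges C})"
    unfolding num_copies_def
  proof (rule count[symmetric])
    show "edges C \<subseteq> edges G'" if "C \<in> copies G' ?T" for C
      using that by (auto simp: copies_def subgraph_def)
  qed (use copies_mono[OF sub, of ?T] finE' in auto)
  also have "\<dots> \<le> (\<Sum>e\<in>edges G'. D e)"
    unfolding D_def using copies_mono[OF sub, of ?T] finC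
    by (intro sum_mono card_mono) auto
  also have "\<dots> = (\<Sum>e\<in>edges G'. D e0)"
    using sub D_eq by (intro sum.cong) (auto simp: subgraph_def)
  finally have 2: "m * num_copies G' ?T \<le> card (edges G') * D e0" by simp
  have "m * (num_copies G' ?T * card (edges G)) \<le> card (edges G') * (card (edges G) * D e0)"
    using mult_right_mono[OF 2, of "card (edges G)"] by (simp add: mult_ac)
  also have "\<dots> = m * (card (edges G') * num_copies G ?T)" using 1 by (simp add: mult_ac)
  finally show ?thesis using m by simp
qed simp

section \<open>The hypercube and its edge-transitivity\<close>

text \<open>Carries the flip coordinate as an argument, so that it need not be recovered from the
  \<open>THE\<close> in \<open>flip_coord\<close>.\<close>

definition differ_at :: "nat \<Rightarrow> nat \<Rightarrow> bool list \<Rightarrow> bool list \<Rightarrow> bool" where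
  "differ_at n i x y \<longleftrightarrow> length x = n \<and> length y = n \<and> i < n \<and> (\<forall>j<n. x ! j \<noteq> y ! j \<longleftrightarrow> j = i)"

lemma differ_at_commute: "differ_at n i x y \<longleftrightarrow> differ_at n i y x"
  by (auto simp: differ_at_def)

lemma differ_at_nth: "differ_at n i x y \<Longrightarrow> j < n \<Longrightarrow> x ! j \<noteq> y ! j \<longleftrightarrow> j = i"
  by (simp add: differ_at_def)

lemma verts_hypercube: "verts (hypercube n) = {x. length x = n}"
  by (simp add: hypercube_def)

lemma edges_hypercube: "edges (hypercube n) = {{x, y} | x y. \<exists>i. differ_at n i x y}"
proof -
  have "(\<exists>!i. i < n \<and> x ! i \<noteq> y ! i) \<longleftrightarrow> (\<exists>i<n. \<forall>j<n. x ! j \<noteq> y ! j \<longleftrightarrow> j = i)" for x y :: "bool list"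
    by blast
  then show ?thesis by (auto simp: hypercube_def differ_at_def)
qed

lemma doubleton_in_hypercube: "{x, y} \<in> edges (hypercube n) \<longleftrightarrow> (\<exists>i. differ_at n i x y)"
  unfolding edges_hypercube using differ_at_commute by (auto simp: doubleton_eq_iff)

lemma flip_coord_eq: "differ_at n i x y \<Longrightarrow> flip_coord {x, y} = i"
  unfolding flip_coord_def differ_at_def by (rule the_equality) auto

lemma simple_hypercube: "simple_graph (hypercube n)"
  unfolding simple_graph_def verts_hypercube edges_hypercube
  by (auto simp: differ_at_def)

lemma finite_bool_lists: "finite {x :: bool list. length x = n}"
  using finite_lists_length_eq[of "UNIV :: bool set" n] by simp

lemma card_bool_lists: "card {x :: bool list. length x = n} = 2 ^ n"
  using card_lists_length_eq[of "UNIV :: bool set" n] by simp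

lemma finite_verts_hypercube: "finite (verts (hypercube n))"
  by (simp add: verts_hypercube finite_bool_lists)

lemma finite_edges_hypercube: "finite (edges (hypercube n))"
proof (rule finite_subset)
  show "edges (hypercube n) \<subseteq> Pow (verts (hypercube n))"
    by (auto simp: verts_hypercube edges_hypercube differ_at_def)
qed (simp add: finite_verts_hypercube)

lemma flip_coord_less:
  assumes "e \<in> edges (hypercube n)" shows "flip_coord e < n"
proof -
  from assms obtain x y i where "e = {x, y}" "differ_at n i x y" by (auto simp: edges_hypercube)
  then show ?thesis using flip_coord_eq[of n i x y] by (simp add: differ_at_def)
qed

text \<open>The map permutes coordinates by the transposition of the two flip coordinates and then
  translates, \<open>\<noteq>\<close> on booleans being addition modulo 2. The translation is chosen
  to send x to x'; then y goes to y', because direction i has become direction j.\<close>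

lemma hypercube_edge_transitive:
  assumes e: "e \<in> edges (hypercube n)" and e': "e' \<in> edges (hypercube n)"
  shows "\<exists>\<phi>. inj_on \<phi> (verts (hypercube n)) \<and> \<phi> ` verts (hypercube n) \<subseteq> verts (hypercube n) \<and>
    (\<forall>a\<in>edges (hypercube n). \<phi> ` a \<in> edges (hypercube n)) \<and> \<phi> ` e = e'"
proof -
  from e obtain x y i where e: "e = {x, y}" and xy: "differ_at n i x y" by (auto simp: edges_hypercube)
  from e' obtain x' y' j where e': "e' = {x', y'}" and xy': "differ_at n j x' y'" by (auto simp: edges_hypercube)
  define \<pi> where "\<pi> k = (if k = j then i else if k = i then j else k)" for k
  have \<pi>_less: "\<pi> k < n" if "k < n" for k using that xy xy' by (auto simp: \<pi>_def differ_at_def)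
  have \<pi>\<pi>: "\<pi> (\<pi> k) = k" for k by (simp add: \<pi>_def)
  define \<phi> where "\<phi> z = map (\<lambda>k. z ! \<pi> k \<noteq> (x ! \<pi> k \<noteq> x' ! k)) [0..<n]" for z
  have len: "length (\<phi> z) = n" for z by (simp add: \<phi>_def)
  have nth: "\<phi> z ! k = (z ! \<pi> k \<noteq> (x ! \<pi> k \<noteq> x' ! k))" if "k < n" for z k using that by (simp add: \<phi>_def)
  have adj: "differ_at n (\<pi> p) (\<phi> u) (\<phi> v)" if "differ_at n p u v" for u v p
    unfolding differ_at_def
  proof (intro conjI allI impI)
    fix k assume k: "k < n"
    have "(\<phi> u ! k \<noteq> \<phi> v ! k) = (u ! \<pi> k \<noteq> v ! \<pi> k)" using nth[OF k] by auto
    also have "\<dots> = (\<pi> k = p)" using differ_at_nth[OF that \<pi>_less[OF k]] .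
    also have "\<dots> = (k = \<pi> p)" using \<pi>\<pi> by metis
    finally show "(\<phi> u ! k \<noteq> \<phi> v ! k) = (k = \<pi> p)" .
  qed (use len that \<pi>_less in \<open>auto simp: differ_at_def\<close>)
  have inj: "inj_on \<phi> (verts (hypercube n))"
  proof (rule inj_onI)
    fix u v assume uv: "u \<in> verts (hypercube n)" "v \<in> verts (hypercube n)" "\<phi> u = \<phi> v"
    show "u = v"
    proof (rule nth_equalityI)
      fix k assume "k < length u"
      then have k: "\<pi> k < n" using \<pi>_less uv(1) by (simp add: verts_hypercube)
      have "\<phi> u ! \<pi> k = \<phi> v ! \<pi> k" using uv(3) by simp
      then show "u ! k = v ! k" using nth[OF k] \<pi>\<pi> by auto
    qed (use uv in \<open>simp add: verts_hypercube\<close>)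
  qed
  have "\<phi> x = x'"
    by (rule nth_equalityI) (use len nth xy' in \<open>auto simp: differ_at_def\<close>)
  moreover have "\<phi> y = y'"
  proof (rule nth_equalityI)
    fix k assume "k < length (\<phi> y)"
    then have k: "k < n" by (simp add: len)
    have "(y ! \<pi> k \<noteq> x ! \<pi> k) = (\<pi> k = i)" using differ_at_nth[OF xy \<pi>_less[OF k]] by blast
    moreover have "(\<pi> k = i) = (k = j)" by (auto simp: \<pi>_def)
    moreover have "(y' ! k \<noteq> x' ! k) = (k = j)" using differ_at_nth[OF xy' k] by blast
    ultimately show "\<phi> y ! k = y' ! k" using nth[OF k, of y] by auto
  qed (use len xy' in \<open>auto simp: differ_at_def\<close>)
  moreover have "\<forall>a\<in>edges (hypercube n). \<phi> ` a \<in> edges (hypercube n)"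
  proof
    fix a assume "a \<in> edges (hypercube n)"
    then obtain u v p where "a = {u, v}" "differ_at n p u v" by (auto simp: edges_hypercube)
    then show "\<phi> ` a \<in> edges (hypercube n)" using adj by (auto simp: doubleton_in_hypercube)
  qed
  moreover have "\<phi> ` verts (hypercube n) \<subseteq> verts (hypercube n)" using len by (auto simp: verts_hypercube)
  ultimately show ?thesis using inj e e' by (intro exI[of _ \<phi>]) auto
qed

text \<open>The characteristic vector of A, through which the density argument can speak of sets
  instead of lists. It determines A only among subsets of \<open>{..<n}\<close>.\<close>

definition vec :: "nat \<Rightarrow> nat set \<Rightarrow> bool list" where
  "vec n A = map (\<lambda>i. i \<in> A) [0..<n]"

lemma length_vec [simp]: "length (vec n A) = n"
  by (simp add: vec_def)

lemma nth_vec [simp]: "i < n \<Longrightarrow> vec n A ! i \<longleftrightarrow> i \<in> A"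
  by (simp add: vec_def)

lemma vec_eq_iff: "A \<subseteq> {..<n} \<Longrightarrow> B \<subseteq> {..<n} \<Longrightarrow> vec n A = vec n B \<longleftrightarrow> A = B"
  by (auto simp: list_eq_iff_nth_eq)

lemma vec_surj:
  assumes "length x = n" obtains A where "A \<subseteq> {..<n}" "x = vec n A"
proof
  show "x = vec n {i. i < n \<and> x ! i}" using assms by (auto intro: nth_equalityI)
qed auto

lemma card_edges_hypercube: "n * 2 ^ n \<le> 2 * card (edges (hypercube n))"
proof -
  let ?A = "SIGMA i:{..<n}. Pow ({..<n} - {i})"
  define h where "h = (\<lambda>(i, A). {vec n A, vec n (insert i A)})"
  have inj: "inj_on h ?A"
  proof (rule inj_onI, clarify)
    fix i A j B
    assume i: "i < n" "A \<subseteq> {..<n} - {i}" and j: "j < n" "B \<subseteq> {..<n} - {j}"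
      and eq: "h (i, A) = h (j, B)"
    have sub: "A \<subseteq> {..<n}" "insert i A \<subseteq> {..<n}" "B \<subseteq> {..<n}" "insert j B \<subseteq> {..<n}" using i j by auto
    have "A = B \<and> insert i A = insert j B \<or> A = insert j B \<and> insert i A = B"
      using eq sub by (simp add: h_def doubleton_eq_iff vec_eq_iff)
    then show "i = j \<and> A = B" using i j by auto
  qed
  have "h ` ?A \<subseteq> edges (hypercube n)"
  proof clarify
    fix i A assume "i < n" "A \<subseteq> {..<n} - {i}"
    then have "differ_at n i (vec n A) (vec n (insert i A))" by (auto simp: differ_at_def)
    then show "h (i, A) \<in> edges (hypercube n)" by (auto simp: h_def doubleton_in_hypercube)
  qed
  then have "card ?A \<le> card (edges (hypercube n))"
    using inj finite_edges_hypercube by (intro card_inj_on_le)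
  moreover have "card ?A = n * 2 ^ (n - 1)" by (simp add: card_Pow)
  moreover have "2 * (n * 2 ^ (n - 1)) = n * 2 ^ n" by (cases n) auto
  ultimately show ?thesis by linarith
qed

text \<open>The factor 2 arises because the edge bound is measured against n 2^n, twice the number
  of edges of the hypercube.\<close>

lemma turan_ratio_hypercube_le:
  assumes m: "m \<ge> 3" and p: "p > 0" and n: "n > 0" and b: "b \<ge> 0"
    and bound: "\<And>G. subgraph G (hypercube n) \<Longrightarrow> is_free (cycle_graph p) G \<Longrightarrow>
      real (card (edges G)) \<le> b * (real n * 2 ^ n)"
  shows "turan_ratio (hypercube n) (cycle_graph m) (cycle_graph p) \<le> 2 * b"
proof -
  let ?Q = "hypercube n" and ?T = "cycle_graph m"
  obtain G where G: "subgraph G ?Q" "is_free (cycle_graph p) G"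
    "gen_turan ?Q ?T (cycle_graph p) = num_copies G ?T"
    using gen_turan_attained[OF finite_verts_hypercube finite_edges_hypercube p] .
  have "num_copies G ?T * card (edges ?Q) \<le> card (edges G) * num_copies ?Q ?T"
    by (rule edge_transitive_cycle_density[OF finite_verts_hypercube finite_edges_hypercube m G(1)
        hypercube_edge_transitive simple_hypercube])
  then have "real (num_copies G ?T) * card (edges ?Q) \<le> card (edges G) * real (num_copies ?Q ?T)"
    by (metis of_nat_mono of_nat_mult)
  also have "\<dots> \<le> b * (real n * 2 ^ n) * num_copies ?Q ?T"
    using bound[OF G(1,2)] by (intro mult_right_mono) auto
  also have "\<dots> \<le> b * (2 * card (edges ?Q)) * num_copies ?Q ?T"
  proof -
    have "real (n * 2 ^ n) \<le> real (2 * card (edges ?Q))" using card_edges_hypercube by (rule of_nat_mono)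
    then show ?thesis using b by (intro mult_right_mono mult_left_mono) auto
  qed
  finally have *: "real (num_copies G ?T) * card (edges ?Q) \<le> (2 * b * num_copies ?Q ?T) * card (edges ?Q)"
    by (simp add: mult_ac)
  have "0 < n * 2 ^ n" using n by simp
  then have "card (edges ?Q) > 0" using card_edges_hypercube[of n] by linarith
  with * have "real (num_copies G ?T) \<le> 2 * b * num_copies ?Q ?T" by simp
  then show ?thesis unfolding turan_ratio_def G(3)
    using b by (cases "num_copies ?Q ?T = 0") (auto simp: divide_le_eq)
qed

section \<open>Dependent random choice\<close>

text \<open>The last representative has to avoid A and m - 1 earlier choices, fewer elements than
  each set contains. This picks the connecting vertices of the lollipop.\<close>

lemma greedy_representatives:
  assumes "finite A" "\<And>i. i < m \<Longrightarrow> finite (F i) \<and> card (F i) \<ge> card A + m"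
  shows "\<exists>b. inj_on b {..<m} \<and> (\<forall>i<m. b i \<in> F i - A)"
  using assms(2)
proof (induction m)
  case (Suc m)
  have "\<exists>b. inj_on b {..<m} \<and> (\<forall>i<m. b i \<in> F i - A)"
    using Suc.prems by (intro Suc.IH) (metis Suc_leD add_Suc_right less_Suc_eq)
  then obtain b where b: "inj_on b {..<m}" "\<forall>i<m. b i \<in> F i - A" by blast
  have "card (A \<union> b ` {..<m}) \<le> card A + m"
    using card_Un_le[of A "b ` {..<m}"] card_image_le[of "{..<m}" b] by simp
  also have "\<dots> < card (F m)" using Suc.prems[of m] by simp
  finally have "\<not> F m \<subseteq> A \<union> b ` {..<m}"
    using assms(1) card_mono[of "A \<union> b ` {..<m}" "F m"] by auto
  then obtain z where z: "z \<in> F m" "z \<notin> A" "z \<notin> b ` {..<m}" by blast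
  have "inj_on (b(m := z)) {..<Suc m}"
    using b(1) z(3) by (auto simp: inj_on_def less_Suc_eq)
  moreover have "\<forall>i<Suc m. (b(m := z)) i \<in> F i - A"
    using b(2) z by (auto simp: less_Suc_eq)
  ultimately show ?case by blast
qed simp

text \<open>For g an incidence indicator, this counts the same triples twice: the left side sums
  codegrees over pairs, the right side squares of degrees.\<close>

lemma sum_pairs_eq_sum_squares:
  fixes g :: "'a \<Rightarrow> 'b \<Rightarrow> real"
  shows "(\<Sum>(u, v)\<in>V \<times> V. \<Sum>x\<in>X. g x u * g x v) = (\<Sum>x\<in>X. (\<Sum>u\<in>V. g x u)\<^sup>2)"
proof -
  have "(\<Sum>(u, v)\<in>V \<times> V. \<Sum>x\<in>X. g x u * g x v) = (\<Sum>x\<in>X. \<Sum>(u, v)\<in>V \<times> V. g x u * g x v)"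
    by (subst sum.swap) (simp add: case_prod_unfold)
  also have "\<dots> = (\<Sum>x\<in>X. (\<Sum>u\<in>V. g x u)\<^sup>2)"
    by (simp add: power2_eq_square sum_product sum.cartesian_product)
  finally show ?thesis .
qed

text \<open>Cauchy-Schwarz in tangent form: f^2 \<ge> 2qf - q^2 pointwise, so a lower bound q on the
  mean is enough.\<close>

lemma sum_squares_ge:
  fixes f :: "'a \<Rightarrow> real" and q :: real
  assumes "(\<Sum>x\<in>X. f x) \<ge> q * card X" "q \<ge> 0"
  shows "(\<Sum>x\<in>X. (f x)\<^sup>2) \<ge> q\<^sup>2 * card X"
proof -
  have "q\<^sup>2 * card X \<le> 2 * q * (\<Sum>x\<in>X. f x) - q\<^sup>2 * card X"
    using mult_left_mono[OF assms(1), of "2 * q"] assms(2) by (simp add: power2_eq_square mult_ac)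
  also have "\<dots> = (\<Sum>x\<in>X. 2 * q * f x - q\<^sup>2)" by (simp add: sum_subtractf sum_distrib_left)
  also have "\<dots> \<le> (\<Sum>x\<in>X. (f x)\<^sup>2)"
  proof (rule sum_mono)
    fix x
    have "0 \<le> (f x - q)\<^sup>2" by simp
    then show "2 * q * f x - q\<^sup>2 \<le> (f x)\<^sup>2" by (simp add: power2_diff algebra_simps)
  qed
  finally show ?thesis .
qed

lemma exists_ge_average:
  fixes f :: "'a \<Rightarrow> real" and c :: real
  assumes "finite Z" "Z \<noteq> {}" "(\<Sum>z\<in>Z. f z) \<ge> c * card Z"
  shows "\<exists>z\<in>Z. f z \<ge> c"
proof (rule ccontr)
  assume "\<not> ?thesis"
  then have "(\<Sum>z\<in>Z. f z) < (\<Sum>z\<in>Z. c)" using assms(1,2) by (intro sum_strict_mono) auto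
  then show False using assms(3) by (simp add: mult.commute)
qed

lemma card_eq_sum_of_bool:
  "finite A \<Longrightarrow> real (card {x \<in> A. P x}) = (\<Sum>x\<in>A. of_bool (P x))"
  by (simp add: sum.If_cases of_bool_def Int_def)

text \<open>Dependent random choice: the common neighbourhood of a suitable pair is large but contains
  few pairs of small codegree, since a pair of codegree \<open>d\<close> lies in it with probability
  \<open>(d / n)\<^sup>2\<close>.\<close>

lemma dependent_random_choice:
  fixes L :: "'a rel" and C :: real
  assumes V: "finite V" "V \<noteq> {}" and L: "L \<subseteq> V \<times> V" "sym L" and C: "C \<ge> 0"
    and dense: "(real (card L))\<^sup>2 \<ge> C * real (card V) ^ 3"
  shows "\<exists>U\<subseteq>V. real (card U) \<ge> C - real M ^ 2 \<and>
    (\<forall>x\<in>U. \<forall>y\<in>U. x \<noteq> y \<longrightarrow> card (L `` {x} \<inter> L `` {y}) \<ge> M)"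
proof -
  define n where "n = real (card V)"
  have n: "n > 0" using V by (simp add: n_def card_gt_0_iff)
  define a :: "'a \<Rightarrow> 'a \<Rightarrow> real" where "a x u = of_bool ((x, u) \<in> L)" for x u
  have codeg: "real (card (L `` {x} \<inter> L `` {y})) = (\<Sum>u\<in>V. a x u * a y u)" for x y
  proof -
    have "L `` {x} \<inter> L `` {y} = {u \<in> V. (x, u) \<in> L \<and> (y, u) \<in> L}" using L by blast
    then show ?thesis using V by (simp add: card_eq_sum_of_bool a_def of_bool_conj)
  qed
  have sym: "a x u = a u x" for x u using L(2) by (auto simp: a_def sym_def)
  have cardL: "real (card L) = (\<Sum>x\<in>V. \<Sum>u\<in>V. a x u)"
  proof -
    have "L = {p \<in> V \<times> V. p \<in> L}" using L by blast
    then have "real (card L) = (\<Sum>p\<in>V \<times> V. of_bool (p \<in> L))"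
      using V card_eq_sum_of_bool[of "V \<times> V" "\<lambda>p. p \<in> L"] by simp
    then show ?thesis by (simp add: sum.cartesian_product a_def case_prod_unfold)
  qed
  define B where "B = {(x, y) \<in> V \<times> V. x \<noteq> y \<and> card (L `` {x} \<inter> L `` {y}) < M}"
  have finB: "finite B" unfolding B_def by (rule finite_subset[of _ "V \<times> V"]) (use V in auto)
  \<comment> \<open>\<open>b u v\<close> counts the bad pairs inside the common neighbourhood of u
    and v. Summed over all (u, v), a pair of B is counted with the square of its codegree, which is
    less than M^2.\<close>
  define b where "b u v = (\<Sum>(x, y)\<in>B. (a x u * a y u) * (a x v * a y v))" for u v
  \<comment> \<open>The mean codegree is at least |L|^2 / n^3; this is the source of the threshold
    n^(3/2) for |L|.\<close>
  have sum1: "(\<Sum>(u, v)\<in>V \<times> V. real (card (L `` {u} \<inter> L `` {v}))) \<ge> C * n\<^sup>2"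
  proof -
    have "C * n\<^sup>2 = C * n ^ 3 / n" using n by (simp add: power2_eq_square power3_eq_cube)
    also have "\<dots> \<le> (real (card L))\<^sup>2 / n"
      using dense n by (intro divide_right_mono) (auto simp: n_def)
    also have "\<dots> = (real (card L) / n)\<^sup>2 * card V"
      using n by (simp add: n_def power2_eq_square)
    also have "\<dots> \<le> (\<Sum>x\<in>V. (\<Sum>u\<in>V. a x u)\<^sup>2)"
      using n by (intro sum_squares_ge) (auto simp: cardL[symmetric] n_def)
    also have "\<dots> = (\<Sum>(u, v)\<in>V \<times> V. real (card (L `` {u} \<inter> L `` {v})))"
      unfolding codeg sum_pairs_eq_sum_squares[symmetric] by (simp add: sym)
    finally show ?thesis .
  qed
  have sum2: "(\<Sum>(u, v)\<in>V \<times> V. b u v) \<le> real M ^ 2 * n\<^sup>2"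
  proof -
    have "(\<Sum>(u, v)\<in>V \<times> V. b u v) = (\<Sum>z\<in>B. (\<Sum>u\<in>V. a (fst z) u * a (snd z) u)\<^sup>2)"
      unfolding sum_pairs_eq_sum_squares[symmetric] b_def by (simp add: case_prod_unfold)
    also have "\<dots> \<le> (\<Sum>z\<in>B. real M ^ 2)"
      unfolding codeg[symmetric] by (intro sum_mono power_mono) (auto simp: B_def)
    also have "\<dots> = real M ^ 2 * card B" by simp
    also have "\<dots> \<le> real M ^ 2 * card (V \<times> V)"
      by (intro mult_left_mono of_nat_mono card_mono) (use V in \<open>auto simp: B_def\<close>)
    finally show ?thesis by (simp add: n_def power2_eq_square card_cartesian_product)
  qed
  have "(\<Sum>z\<in>V \<times> V. real (card (L `` {fst z} \<inter> L `` {snd z})) - b (fst z) (snd z))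
      \<ge> (C - real M ^ 2) * card (V \<times> V)"
    using sum1 sum2 by (simp add: sum_subtractf case_prod_unfold card_cartesian_product n_def
        power2_eq_square algebra_simps)
  from exists_ge_average[OF _ _ this] V obtain z where z: "z \<in> V \<times> V"
    "real (card (L `` {fst z} \<inter> L `` {snd z})) - b (fst z) (snd z) \<ge> C - real M ^ 2"
    by blast
  define u v where "u = fst z" "v = snd z"
  define W where "W = L `` {u} \<inter> L `` {v}"
  define B' where "B' = {p \<in> B. fst p \<in> W \<and> snd p \<in> W}"
  have WV: "W \<subseteq> V" using L by (auto simp: W_def)
  have "real (card B') = b u v"
    unfolding B'_def b_def
    by (subst card_eq_sum_of_bool[OF finB], intro sum.cong)
      (auto simp: a_def W_def sym[unfolded a_def] of_bool_conj split: prod.splits intro: symD[OF L(2)])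
  \<comment> \<open>Removing one end of every bad pair suffices and costs at most
    \<open>b u v\<close> vertices, which the averaged difference has already paid for.\<close>
  define U where "U = W - fst ` B'"
  have finB': "finite B'" using finB by (simp add: B'_def)
  have "real (card U) \<ge> C - real M ^ 2"
  proof -
    have "card W \<le> card U + card (fst ` B')"
      unfolding U_def using diff_card_le_card_Diff[of "fst ` B'" W] finB' by simp
    also have "card (fst ` B') \<le> card B'" using finB' by (rule card_image_le)
    finally have "real (card W) \<le> card U + card B'" by simp
    then show ?thesis using z(2) \<open>real (card B') = b u v\<close> by (simp add: u_v_def W_def)
  qed
  moreover have "card (L `` {x} \<inter> L `` {y}) \<ge> M" if "x \<in> U" "y \<in> U" "x \<noteq> y" for x y
  proof (rule ccontr)
    assume "\<not> ?thesis"
    then have "(x, y) \<in> B'" using that WV by (auto simp: B'_def B_def U_def)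
    then show False using that(1) by (force simp: U_def)
  qed
  ultimately show ?thesis using WV by (intro exI[of _ U]) (auto simp: U_def)
qed

text \<open>The vertices \<open>u 1, \<dots>, u (2 * s)\<close> form the cycle and \<open>u 0\<close> is the pendant vertex.\<close>

lemma dense_lollipop:
  fixes L :: "'a rel"
  assumes V: "finite V" "V \<noteq> {}" and L: "L \<subseteq> V \<times> V" "sym L" and s: "s \<ge> 2"
    and dense: "(real (card L))\<^sup>2 \<ge> real ((2 * s + 1)\<^sup>2 + s) * real (card V) ^ 3"
  shows "\<exists>u. inj_on u {..2 * s} \<and> (\<forall>j<2 * s. (u j, u (Suc j)) \<in> L) \<and> (u (2 * s), u 1) \<in> L"
proof -
  \<comment> \<open>M = 2s + 1 covers s vertices to avoid and s + 1 connecting vertices to choose; C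
    = M^2 + s then leaves s vertices in U.\<close>
  from dependent_random_choice[OF V L _ dense, of "2 * s + 1"]
  obtain U where U: "U \<subseteq> V" "real (card U) \<ge> real ((2 * s + 1)\<^sup>2 + s) - real (2 * s + 1) ^ 2"
    and codeg: "\<And>x y. x \<in> U \<Longrightarrow> y \<in> U \<Longrightarrow> x \<noteq> y \<Longrightarrow> card (L `` {x} \<inter> L `` {y}) \<ge> 2 * s + 1"
    by auto
  have "s \<le> card U" using U(2) by simp
  then obtain A where A: "A \<subseteq> U" "card A = s" "finite A" by (rule obtain_subset_with_card_n)
  then obtain a where a: "bij_betw a {..<s} A"
    using ex_bij_betw_nat_finite[of A] by (auto simp: atLeast0LessThan)
  have aA: "a i \<in> A" if "i < s" for i using a that by (auto simp: bij_betw_def)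
  have a_inj: "a i = a j \<longleftrightarrow> i = j" if "i < s" "j < s" for i j
    using a that by (auto simp: bij_betw_def inj_on_def)
  \<comment> \<open>For i < s these join consecutive a's cyclically. \<open>F s\<close> only has to
    provide a neighbour of \<open>a 0\<close> as pendant vertex; intersecting with the neighbourhood
    of \<open>a 1\<close> makes the codegree bound apply to it too.\<close>
  define F where "F i = (if i < s then L `` {a i} \<inter> L `` {a (Suc i mod s)} else L `` {a 0} \<inter> L `` {a 1})" for i
  have "finite (L `` {x})" for x using L(1) V(1) by (auto intro: finite_subset)
  then have finF: "finite (F i)" for i by (simp add: F_def)
  have cardF: "card (F i) \<ge> s + (s + 1)" for i
  proof -
    have "card (L `` {a p} \<inter> L `` {a q}) \<ge> 2 * s + 1" if "p < s" "q < s" "p \<noteq> q" for p q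
      using that aA A(1) by (intro codeg) (auto simp: a_inj)
    from this[of i "Suc i mod s"] this[of 0 1] show ?thesis
      using s Suc_mod_less[of i s] Suc_mod_neq[of i s] by (auto simp: F_def)
  qed
  have "\<exists>b. inj_on b {..<s + 1} \<and> (\<forall>i<s + 1. b i \<in> F i - A)"
    by (rule greedy_representatives) (use finF cardF A in auto)
  then obtain b where b: "inj_on b {..<s + 1}" "\<And>i. i \<le> s \<Longrightarrow> b i \<in> F i - A" by (auto simp: less_Suc_eq_le)
  \<comment> \<open>The order is b_s, a_0, b_0, a_1, b_1, ..., a_(s-1), b_(s-1), where b_(s-1) is
    also adjacent to a_0.\<close>
  define u where "u j = (if j = 0 then b s else if odd j then a (j div 2) else b (j div 2 - 1))" for j
  have b_inj: "b i = b j \<longleftrightarrow> i = j" if "i \<le> s" "j \<le> s" for i j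
    using b(1) that by (auto simp: inj_on_def)
  have ab: "a i \<noteq> b j" "b j \<noteq> a i" if "i < s" "j \<le> s" for i j using b(2)[of j] aA[of i] that by auto
  have "inj_on u {..2 * s}"
  proof (rule inj_onI)
    fix i j assume ij: "i \<in> {..2 * s}" "j \<in> {..2 * s}" "u i = u j"
    have lt: "k div 2 < s" if "odd k" "k \<le> 2 * s" for k using that by (auto elim!: oddE)
    have le: "k div 2 - 1 < s" if "k \<le> 2 * s" for k using that s by auto
    show "i = j"
    proof (cases "even i"; cases "even j")
      assume o: "odd i" "odd j"
      then have "i div 2 = j div 2" using ij lt a_inj by (auto simp: u_def split: if_splits)
      with o show ?thesis by (metis odd_two_times_div_two_succ)
    next
      assume o: "odd i" "even j"
      then show ?thesis using ij lt[of i] le[of j] ab[of "i div 2" s] ab[of "i div 2" "j div 2 - 1"]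
        by (auto simp: u_def split: if_splits)
    next
      assume o: "even i" "odd j"
      then show ?thesis using ij lt[of j] le[of i] ab[of "j div 2" s] ab[of "j div 2" "i div 2 - 1"]
        by (auto simp: u_def split: if_splits)
    next
      assume o: "even i" "even j"
      then show ?thesis using ij le[of i] le[of j] b_inj by (auto simp: u_def split: if_splits elim!: evenE)
    qed
  qed
  moreover have "(u j, u (Suc j)) \<in> L" if j: "j < 2 * s" for j
  proof (cases "odd j")
    case True
    then obtain i where i: "j = 2 * i + 1" by (auto elim!: oddE)
    then have "u j = a i" "u (Suc j) = b i" "i < s" using j by (auto simp: u_def)
    then show ?thesis using b(2)[of i] by (simp add: F_def)
  next
    case False
    then obtain i where i: "j = 2 * i" by (auto elim!: evenE)
    have "u (Suc j) = a i" using i by (simp add: u_def)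
    moreover have "(a i, u j) \<in> L"
    proof (cases "i = 0")
      case True
      then show ?thesis using i b(2)[of s] by (simp add: u_def F_def)
    next
      case False
      then obtain p where "i = Suc p" by (cases i) auto
      then show ?thesis using i j b(2)[of p] by (simp add: u_def F_def)
    qed
    ultimately show ?thesis using L(2) by (simp add: symD)
  qed
  moreover have "(u (2 * s), u 1) \<in> L"
  proof -
    have "b (s - 1) \<in> F (s - 1)" using b(2)[of "s - 1"] by simp
    then have "(a 0, b (s - 1)) \<in> L" using s by (simp add: F_def)
    moreover have "u (2 * s) = b (s - 1)" "u 1 = a 0" using s by (auto simp: u_def)
    ultimately show ?thesis using L(2) by (simp add: symD)
  qed
  ultimately show ?thesis by blast
qed

text \<open>By Cauchy-Schwarz over W, the common neighbourhoods of all ordered pairs from V have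
  total size at least t^2 / |W|. The diagonal, at most |V| |W|, is removed because c and c' must
  differ; \<open>big\<close> says that something positive remains.\<close>

lemma dense_common_link:
  fixes R :: "('a \<times> 'b) set" and t :: real
  assumes V: "finite V" "finite W" and R: "R \<subseteq> V \<times> W" and t: "t \<ge> 0" "real (card R) \<ge> t"
    and big: "t\<^sup>2 > real (card W) ^ 2 * card V"
  shows "\<exists>c\<in>V. \<exists>c'\<in>V. c \<noteq> c' \<and>
    real (card (R `` {c} \<inter> R `` {c'})) \<ge> (t\<^sup>2 / card W - real (card V) * card W) / real (card V) ^ 2"
proof -
  define v w where "v = real (card V)" and "w = real (card W)"
  have "t\<^sup>2 > 0" by (rule le_less_trans[OF _ big]) simp
  then have "t \<noteq> 0" by simp
  then have "card R > 0" using t by linarith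
  then have "V \<noteq> {}" "W \<noteq> {}" using R by auto
  then have pos: "v > 0" "w > 0" using V by (auto simp: v_def w_def card_gt_0_iff)
  define g :: "'b \<Rightarrow> 'a \<Rightarrow> real" where "g p c = of_bool ((c, p) \<in> R)" for p c
  define f where "f z = real (card (R `` {fst z} \<inter> R `` {snd z}))" for z
  have f: "f z = (\<Sum>p\<in>W. g p (fst z) * g p (snd z))" for z
  proof -
    have "R `` {fst z} \<inter> R `` {snd z} = {p \<in> W. (fst z, p) \<in> R \<and> (snd z, p) \<in> R}" using R by blast
    then show ?thesis using V by (simp add: f_def card_eq_sum_of_bool g_def of_bool_conj)
  qed
  have cardR: "real (card R) = (\<Sum>p\<in>W. \<Sum>c\<in>V. g p c)"
  proof -
    have "R = {z \<in> V \<times> W. z \<in> R}" using R by blast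
    then have "real (card R) = (\<Sum>z\<in>V \<times> W. of_bool (z \<in> R))"
      using V card_eq_sum_of_bool[of "V \<times> W" "\<lambda>z. z \<in> R"] by simp
    also have "\<dots> = (\<Sum>c\<in>V. \<Sum>p\<in>W. g p c)" by (simp add: sum.cartesian_product g_def case_prod_unfold)
    finally show ?thesis by (subst sum.swap)
  qed
  have "t\<^sup>2 / w = (t / w)\<^sup>2 * card W" using pos by (simp add: w_def power2_eq_square)
  also have "\<dots> \<le> (\<Sum>p\<in>W. (\<Sum>c\<in>V. g p c)\<^sup>2)"
    using t pos by (intro sum_squares_ge) (auto simp: w_def cardR[symmetric])
  also have "\<dots> = (\<Sum>z\<in>V \<times> V. f z)"
    unfolding f sum_pairs_eq_sum_squares[symmetric] by (simp add: case_prod_unfold)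
  finally have total: "(\<Sum>z\<in>V \<times> V. f z) \<ge> t\<^sup>2 / w" .
  define D where "D = {z \<in> V \<times> V. fst z = snd z}"
  define Z where "Z = {z \<in> V \<times> V. fst z \<noteq> snd z}"
  have fin: "finite D" "finite Z" using V by (auto simp: D_def Z_def)
  have "(\<Sum>z\<in>V \<times> V. f z) = (\<Sum>z\<in>D. f z) + (\<Sum>z\<in>Z. f z)"
    by (subst sum.union_disjoint[symmetric]) (use fin in \<open>auto simp: D_def Z_def intro!: sum.cong\<close>)
  moreover have "(\<Sum>z\<in>D. f z) \<le> v * w"
  proof -
    have "f z \<le> w" for z
      unfolding f_def w_def using R V by (intro of_nat_mono card_mono) auto
    then have "(\<Sum>z\<in>D. f z) \<le> card D * w" by (intro sum_bounded_above) auto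
    also have "D = (\<lambda>c. (c, c)) ` V" by (auto simp: D_def)
    then have "card D = card V" by (simp add: card_image inj_on_def)
    finally show ?thesis by (simp add: v_def)
  qed
  ultimately have Zsum: "(\<Sum>z\<in>Z. f z) \<ge> t\<^sup>2 / w - v * w" using total by linarith
  have T: "t\<^sup>2 / w - v * w > 0" using big pos by (simp add: v_def w_def field_simps power2_eq_square)
  have "Z \<noteq> {}" using Zsum T by auto
  have "card Z \<le> card (V \<times> V)" using V by (intro card_mono) (auto simp: Z_def)
  then have Z2: "real (card Z) \<le> v\<^sup>2" by (simp add: v_def card_cartesian_product power2_eq_square flip: of_nat_mult)
  have "(t\<^sup>2 / w - v * w) / v\<^sup>2 * card Z \<le> (t\<^sup>2 / w - v * w) / v\<^sup>2 * v\<^sup>2"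
    using Z2 T pos by (intro mult_left_mono) auto
  also have "\<dots> \<le> (\<Sum>z\<in>Z. f z)" using Zsum pos by simp
  finally obtain z where "z \<in> Z" "f z \<ge> (t\<^sup>2 / w - v * w) / v\<^sup>2"
    using exists_ge_average[OF fin(2) \<open>Z \<noteq> {}\<close>] by blast
  then show ?thesis
    unfolding f_def v_def w_def Z_def by (intro bexI[of _ "fst z"] bexI[of _ "snd z"]) auto
qed

section \<open>Lifting cycles to the hypercube\<close>

text \<open>The path in the hypercube alternating between edges and vertices of the path \<open>v\<close>.\<close>

primrec zigzag :: "'a \<Rightarrow> (nat \<Rightarrow> 'a) \<Rightarrow> nat \<Rightarrow> 'a set list" where
  "zigzag c v 0 = []"
| "zigzag c v (Suc m) = zigzag c v m @ [{c, v m, v (Suc m)}, {c, v (Suc m)}]"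

lemma length_zigzag [simp]: "length (zigzag c v m) = 2 * m"
  by (induction m) auto

lemma set_zigzag: "set (zigzag c v m) = (\<Union>j<m. {{c, v j, v (Suc j)}, {c, v (Suc j)}})"
  by (induction m) (auto simp: lessThan_Suc)

lemma zigzag_eq_Nil [simp]: "zigzag c v m = [] \<longleftrightarrow> m = 0"
  by (cases m) auto

lemma last_zigzag: "m > 0 \<Longrightarrow> last (zigzag c v m) = {c, v m}"
  by (cases m) auto

lemma hd_zigzag: "m > 0 \<Longrightarrow> hd (zigzag c v m) = {c, v 0, v 1}"
  by (induction m) (auto simp: hd_append)

lemma successively_zigzag:
  assumes "\<And>j. j < m \<Longrightarrow> P {c, v j, v (Suc j)} {c, v (Suc j)}"
    and "\<And>j. j < m \<Longrightarrow> P {c, v j} {c, v j, v (Suc j)}"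
  shows "successively P (zigzag c v m)"
  using assms
proof (induction m)
  case (Suc m)
  have "successively P (zigzag c v m)" by (rule Suc.IH; rule Suc.prems; simp)
  moreover have "m = 0 \<or> last (zigzag c v m) = {c, v m}" using last_zigzag[of m c v] by auto
  moreover have "P {c, v m, v (Suc m)} {c, v (Suc m)}" "P {c, v m} {c, v m, v (Suc m)}"
    by (rule Suc.prems; simp)+
  ultimately show ?case by (auto simp: successively_append_iff)
qed simp

text \<open>Both sets added in a step contain \<open>v (Suc m)\<close>, which no earlier set
  contains.\<close>

lemma distinct_zigzag:
  assumes "inj_on v {..m}" "c \<notin> v ` {..m}"
  shows "distinct (zigzag c v m)"
  using assms
proof (induction m)
  case (Suc m)
  have ne: "v (Suc m) \<noteq> v j" "v j \<noteq> v (Suc m)" "c \<noteq> v j" if "j \<le> m" for j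
    using Suc.prems that inj_onD[OF Suc.prems(1), of "Suc m" j] inj_onD[OF Suc.prems(1), of j "Suc m"] by auto
  have c: "c \<noteq> v (Suc m)" using Suc.prems(2) by auto
  have out: "v (Suc m) \<notin> \<Union> (set (zigzag c v m))" using ne c by (auto simp: set_zigzag)
  have "distinct (zigzag c v m)"
  proof (rule Suc.IH)
    show "inj_on v {..m}" by (rule inj_on_subset[OF Suc.prems(1)]) simp
  qed (use Suc.prems(2) in auto)
  moreover have "{c, v m, v (Suc m)} \<noteq> {c, v (Suc m)}" using ne[of m] by auto
  ultimately show ?case using out by auto
qed simp

lemma is_free_cycle_nth:
  assumes "is_free (cycle_graph (length xs)) G" "simple_graph G" "distinct xs" "length xs \<ge> 3"
    and "successively (\<lambda>x y. {x, y} \<in> edges G) xs" "{last xs, hd xs} \<in> edges G"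
  shows False
  using cyc_nth_in_copies[of xs G] assms by (auto simp: is_free_def)

text \<open>Triples are ordered so that the image of \<open>{c}\<close> is a symmetric relation, the
  pair graph of c. All three edges descend from the one vertex S + {c,x,y}, so triples are counted
  by down-degrees and convexity applies.\<close>

definition down_link :: "nat \<Rightarrow> bool list graph \<Rightarrow> nat set \<Rightarrow> (nat \<times> nat \<times> nat) set" where
  "down_link n G S = {(c, x, y). distinct [c, x, y] \<and> {c, x, y} \<subseteq> {..<n} - S \<and>
     {vec n (S \<union> {c, x, y}), vec n (S \<union> {x, y})} \<in> edges G \<and>
     {vec n (S \<union> {c, x, y}), vec n (S \<union> {c, y})} \<in> edges G \<and>
     {vec n (S \<union> {c, x, y}), vec n (S \<union> {c, x})} \<in> edges G}"

text \<open>With \<open>c\<close> added, the \<open>2 * s\<close>-cycle gives the \<open>4 * s\<close>-cycle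
  alternating between its edges and its vertices. For the longer cycle, one walks along the path
  \<open>u 0, \<dots>, u (2 * s)\<close> with \<open>c\<close>, exchanges \<open>c\<close> for \<open>c'\<close> at the last edge, returns through
  \<open>u (2 * s), u 1, u 0\<close>, and exchanges back at the first edge.\<close>

lemma not_free_if_lollipop:
  assumes simp: "simple_graph G" and S: "S \<subseteq> {..<n}" and s: "s \<ge> 2" and c: "c \<noteq> c'"
    and u: "inj_on u {..2 * s}"
    and path: "\<And>j. j < 2 * s \<Longrightarrow> (u j, u (Suc j)) \<in> down_link n G S `` {c} \<inter> down_link n G S `` {c'}"
    and close: "(u (2 * s), u 1) \<in> down_link n G S `` {c} \<inter> down_link n G S `` {c'}"
  shows "\<not> is_free (cycle_graph (4 * s)) G" "\<not> is_free (cycle_graph (4 * s + 6)) G"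
proof -
  have u_eq: "u i = u j \<longleftrightarrow> i = j" if "i \<le> 2 * s" "j \<le> 2 * s" for i j
    using u that by (auto simp: inj_on_def)
  define \<phi> where "\<phi> X = vec n (S \<union> X)" for X
  define E where "E X Y \<longleftrightarrow> {\<phi> X, \<phi> Y} \<in> edges G" for X Y
  have E_sym: "E X Y \<Longrightarrow> E Y X" for X Y by (simp add: E_def insert_commute)
  have link: "E {d, x, y} {x, y}" "E {d, x, y} {d, y}" "E {d, x, y} {d, x}"
    "E {x, y} {d, x, y}" "E {d, y} {d, x, y}" "E {d, x} {d, x, y}"
    "d \<noteq> x" "d \<noteq> y" "d \<in> {..<n} - S" "x \<in> {..<n} - S" "y \<in> {..<n} - S"
    if "(x, y) \<in> down_link n G S `` {d}" for d x y
    using that by (auto simp: down_link_def E_def \<phi>_def insert_commute)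
  have inS: "u j \<in> {..<n} - S" "c \<noteq> u j" "c' \<noteq> u j" if "j \<le> 2 * s" for j
  proof -
    have "u j \<in> {..<n} - S \<and> c \<noteq> u j \<and> c' \<noteq> u j"
    proof (cases "j < 2 * s")
      case True
      then show ?thesis using path[OF True] link[of "u j" "u (Suc j)" c] link[of "u j" "u (Suc j)" c'] by blast
    next
      case False
      then have "j = 2 * s" using that by simp
      then show ?thesis using close link[of "u (2 * s)" "u 1" c] link[of "u (2 * s)" "u 1" c'] by blast
    qed
    then show "u j \<in> {..<n} - S" "c \<noteq> u j" "c' \<noteq> u j" by auto
  qed
  have cS: "c \<in> {..<n} - S" "c' \<in> {..<n} - S" using close link(9) by blast+
  have \<phi>_inj: "inj_on \<phi> (Pow ({..<n} - S))"
  proof (rule inj_onI)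
    fix X Y assume "X \<in> Pow ({..<n} - S)" "Y \<in> Pow ({..<n} - S)" "\<phi> X = \<phi> Y"
    then show "X = Y" using S vec_eq_iff[of "S \<union> X" n "S \<union> Y"] unfolding \<phi>_def by blast
  qed
  \<comment> \<open>Reduces both claims to a cyclic list of distinct subsets of
    \<open>{..<n} - S\<close>; \<phi> adds S and passes to vectors.\<close>
  have cycle: False if "is_free (cycle_graph (length Xs)) G" "distinct Xs" "length Xs \<ge> 3"
    "\<Union> (set Xs) \<subseteq> {..<n} - S" "successively E Xs" "E (last Xs) (hd Xs)" for Xs
  proof (rule is_free_cycle_nth[of "map \<phi> Xs" G])
    show "distinct (map \<phi> Xs)"
      using that(2,4) \<phi>_inj by (auto simp: distinct_map intro: inj_on_subset)
    have "Xs \<noteq> []" using that(3) by auto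
    then show "{last (map \<phi> Xs), hd (map \<phi> Xs)} \<in> edges G"
      using that(6) by (simp add: last_map hd_map E_def)
    show "successively (\<lambda>x y. {x, y} \<in> edges G) (map \<phi> Xs)"
      using that(5) by (simp add: successively_map E_def)
  qed (use that simp in auto)

  show "\<not> is_free (cycle_graph (4 * s)) G"
  proof
    \<comment> \<open>The shift v drops the pendant vertex \<open>u 0\<close>. The zigzag follows
      the 2s - 1 path edges, and the closing edge from \<open>v m\<close> to \<open>v 0\<close> is
      appended by hand.\<close>
    define m where "m = 2 * s - 1"
    have m: "m > 0" "Suc m = 2 * s" using s by (auto simp: m_def)
    define v where "v j = u (Suc j)" for j
    define Xs where "Xs = zigzag c v m @ [{c, v m, v 0}, {c, v 0}]"
    assume free: "is_free (cycle_graph (4 * s)) G"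
    show False
    proof (rule cycle[of Xs])
      have "length Xs = 4 * s" using m by (simp add: Xs_def)
      then show "is_free (cycle_graph (length Xs)) G" "length Xs \<ge> 3" using free s by auto
      have v_eq: "v i = v j \<longleftrightarrow> i = j" if "i \<le> m" "j \<le> m" for i j
        using u_eq[of "Suc i" "Suc j"] that m by (simp add: v_def)
      then have v_inj: "inj_on v {..m}" by (auto simp: inj_on_def)
      have v_out: "c \<noteq> v j" "v j \<in> {..<n} - S" if "j \<le> m" for j using inS[of "Suc j"] that m by (auto simp: v_def)
      have vv: "v 0 \<noteq> v (Suc j)" "v 0 \<noteq> v m" if "j < m" for j
        using v_eq[of 0 "Suc j"] v_eq[of 0 m] m that by auto
      have "{c, v 0} \<notin> set (zigzag c v m)"
      proof
        assume "{c, v 0} \<in> set (zigzag c v m)"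
        then obtain j where j: "j < m" "v (Suc j) \<in> {c, v 0}" by (auto simp: set_zigzag)
        then show False using vv(1)[OF j(1)] v_out(1)[of "Suc j"] by auto
      qed
      moreover have "{c, v m, v 0} \<notin> set (zigzag c v m)"
      proof
        assume "{c, v m, v 0} \<in> set (zigzag c v m)"
        then obtain j where j: "j < m" "{c, v m, v 0} = {c, v j, v (Suc j)} \<or> {c, v m, v 0} = {c, v (Suc j)}"
          by (auto simp: set_zigzag)
        have "{v m, v 0} \<subseteq> {v j, v (Suc j)}" using j v_out[of m] v_out[of 0] by auto
        then have "{m, 0} \<subseteq> {j, Suc j}"
          using v_eq[of m j] v_eq[of m "Suc j"] v_eq[of 0 j] v_eq[of 0 "Suc j"] j(1) by auto
        then show False using j(1) m s by auto
      qed
      moreover have "{c, v m, v 0} \<noteq> {c, v 0}" using v_out[of m] vv(2)[of 0] m by auto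
      ultimately show "distinct Xs" using distinct_zigzag[OF v_inj, of c] v_out by (auto simp: Xs_def)
      show "\<Union> (set Xs) \<subseteq> {..<n} - S" using v_out(2) cS m by (auto simp: Xs_def set_zigzag)
      have path': "(v j, v (Suc j)) \<in> down_link n G S `` {c}" if "j < m" for j
        using path[of "Suc j"] that m by (simp add: v_def)
      have close': "(v m, v 0) \<in> down_link n G S `` {c}" using close m by (simp add: v_def)
      have "successively E (zigzag c v m)"
        by (rule successively_zigzag) (use link path' in auto)
      then show "successively E Xs" using close' link m by (simp add: Xs_def successively_append_iff last_zigzag)
      show "E (last Xs) (hd Xs)" using link(6)[OF path'[of 0]] m by (simp add: Xs_def hd_append hd_zigzag)
    qed
  qed

  show "\<not> is_free (cycle_graph (4 * s + 6)) G"
  proof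
    define m where "m = 2 * s - 1"
    have m: "m > 2" "Suc m = 2 * s" using s by (auto simp: m_def)
    \<comment> \<open>ab is the pendant edge with foot b, xy the last edge of the path, and yb the
      edge closing the cycle.\<close>
    define a b x y where "a = u 0" and "b = u 1" and "x = u m" and "y = u (2 * s)"
    \<comment> \<open>The first and the last set contain neither c nor c' and are the two exchanges;
      between them c' passes from xy over yb to ab. The length is 2m + 1 + 7 = 4s + 6.\<close>
    define T where "T = [{x, y}, {c', x, y}, {c', y}, {c', y, b}, {c', b}, {c', a, b}, {a, b}]"
    define Xs where "Xs = zigzag c u m @ {c, x, y} # T"
    assume free: "is_free (cycle_graph (4 * s + 6)) G"
    show False
    proof (rule cycle[of Xs])
      have "length Xs = 4 * s + 6" using m by (simp add: Xs_def T_def)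
      then show "is_free (cycle_graph (length Xs)) G" "length Xs \<ge> 3" using free by auto
      have ne: "distinct [a, b, x, y]" using m by (auto simp: a_def b_def x_def y_def u_eq)
      have ne': "c \<noteq> a" "c \<noteq> b" "c \<noteq> x" "c \<noteq> y" "c' \<noteq> a" "c' \<noteq> b" "c' \<noteq> x" "c' \<noteq> y"
        unfolding a_def b_def x_def y_def
        using inS[of 0] inS[of 1] inS[of m] inS[of "2 * s"] m by simp_all
      have "distinct (zigzag c u m)"
      proof (rule distinct_zigzag)
        show "inj_on u {..m}" by (rule inj_on_subset[OF u]) (use m in simp)
        have "c \<noteq> u j" if "j \<le> m" for j using inS(2)[of j] that m by simp
        then show "c \<notin> u ` {..m}" by auto
      qed
      moreover have y: "y \<noteq> u j" if "j \<le> m" for j using that m by (simp add: y_def u_eq)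
      have "y \<notin> X" if X: "X \<in> set (zigzag c u m)" for X
      proof -
        from X obtain j where "j < m" "X \<subseteq> {c, u j, u (Suc j)}" by (auto simp: set_zigzag)
        then show ?thesis using y[of j] y[of "Suc j"] ne'(4) by auto
      qed
      then have "{c, x, y} \<notin> set (zigzag c u m)" by blast
      \<comment> \<open>The element c separates the two halves of the list: it lies in every set
        before T and in none of T.\<close>
      moreover have cT: "c \<notin> X" if "X \<in> set T" for X using that ne' c by (auto simp: T_def)
      have "c \<in> X" if "X \<in> set (zigzag c u m)" for X using that by (auto simp: set_zigzag)
      then have "set (zigzag c u m) \<inter> set T = {}" using cT by blast
      moreover have "{c, x, y} \<notin> set T" using cT by blast
      \<comment> \<open>The membership patterns of c', a, b, x, y already tell the seven sets
        apart.\<close>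
      moreover have "distinct (map (\<lambda>X. (c' \<in> X, a \<in> X, b \<in> X, x \<in> X, y \<in> X)) T)"
        using ne ne' unfolding T_def by auto
      then have "distinct T" by (simp only: distinct_map)
      ultimately show "distinct Xs" by (auto simp: Xs_def)
      show "\<Union> (set Xs) \<subseteq> {..<n} - S"
        using inS(1) cS m by (auto simp: Xs_def T_def set_zigzag a_def b_def x_def y_def)
      have xy: "(x, y) \<in> down_link n G S `` {c} \<inter> down_link n G S `` {c'}"
        using path[of m] m by (simp add: x_def y_def)
      have yb: "(y, b) \<in> down_link n G S `` {c} \<inter> down_link n G S `` {c'}"
        using close by (simp add: y_def b_def)
      have ab: "(a, b) \<in> down_link n G S `` {c} \<inter> down_link n G S `` {c'}"
        using path[of 0] s by (simp add: a_def b_def)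
      have "successively E (zigzag c u m)"
        by (rule successively_zigzag) (use link path m in auto)
      moreover have "last (zigzag c u m) = {c, x}" using m by (simp add: last_zigzag x_def)
      moreover have "successively E ({c, x, y} # T)"
        unfolding T_def using xy yb ab by (simp add: link)
      ultimately show "successively E Xs"
        using xy by (simp add: Xs_def successively_append_iff link)
      have "hd (zigzag c u m) = {c, a, b}" using m by (simp add: hd_zigzag a_def b_def)
      then show "E (last Xs) (hd Xs)" using ab m by (simp add: Xs_def T_def hd_append link)
    qed
  qed
qed

section \<open>Edge density of cycle-free subgraphs\<close>

lemma cube_tangent:
  fixes x y :: real
  assumes "x \<ge> 0" "y \<ge> 0"
  shows "3 * x\<^sup>2 * y - 2 * x ^ 3 \<le> y ^ 3"
proof -
  have "0 \<le> (y - x)\<^sup>2 * (y + 2 * x)" using assms by simp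
  also have "\<dots> = y ^ 3 - (3 * x\<^sup>2 * y - 2 * x ^ 3)" by algebra
  finally show ?thesis by simp
qed

text \<open>Convexity as a tangent bound: for d \<ge> 2 the product dominates (d - 2)^3, hence the
  tangent of the cube at x. For d < 2 the truncated product is 0 while the left side is nonpositive.
  The shift by 2 is paid for by the summand 2 in \<open>dense_down_link\<close>.\<close>

lemma falling_cube_tangent:
  fixes x :: real and d :: nat
  assumes "x \<ge> 0"
  shows "3 * x\<^sup>2 * (real d - 2) - 2 * x ^ 3 \<le> real (d * (d - 1) * (d - 2))"
proof (cases "d \<ge> 2")
  case True
  then obtain y where d: "d = y + 2" by (metis add.commute le_Suc_ex)
  have "real y ^ 3 \<le> real (d * (d - 1) * (d - 2))"
  proof -
    have "y * y * y \<le> d * (d - 1) * (d - 2)" unfolding d by (intro mult_mono) auto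
    then have "real (y * y * y) \<le> real (d * (d - 1) * (d - 2))" by (rule of_nat_mono)
    then show ?thesis by (simp add: power3_eq_cube)
  qed
  then show ?thesis using cube_tangent[OF assms, of "real y"] by (simp add: d)
next
  case False
  then have "3 * x\<^sup>2 * (real d - 2) \<le> 0" by (intro mult_nonneg_nonpos) auto
  moreover have "x ^ 3 \<ge> 0" using assms by simp
  ultimately show ?thesis by (smt (verit) of_nat_0_le_iff)
qed

lemma card_distinct_triples:
  assumes "finite D"
  shows "card {(c, x, y). distinct [c, x, y] \<and> {c, x, y} \<subseteq> D} = card D * (card D - 1) * (card D - 2)"
proof -
  have "{(c, x, y). distinct [c, x, y] \<and> {c, x, y} \<subseteq> D} = (SIGMA c:D. SIGMA x:D - {c}. D - {c, x})"
    by auto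
  moreover have "card (SIGMA x:D - {c}. D - {c, x}) = (card D - 1) * (card D - 2)" if "c \<in> D" for c
  proof -
    have "card (SIGMA x:D - {c}. D - {c, x}) = (\<Sum>x\<in>D - {c}. card (D - {c, x}))"
      using assms by (intro card_SigmaI) auto
    also have "\<dots> = (\<Sum>x\<in>D - {c}. card D - 2)"
      using assms that by (intro sum.cong) (auto simp: card_Diff_subset)
    also have "\<dots> = (card D - 1) * (card D - 2)" using assms that by simp
    finally show ?thesis .
  qed
  ultimately show ?thesis using assms by (simp add: card_SigmaI mult.assoc)
qed

text \<open>The triples of downward edges at a vertex \<open>A\<close> are distributed over the bases
  \<open>S = A - {c, x, y}\<close>, of which there are only \<open>2 ^ n\<close>.\<close>

lemma dense_down_link:
  fixes x :: real
  assumes G: "subgraph G (hypercube n)" and x: "x \<ge> 0"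
    and dense: "real (card (edges G)) \<ge> (x + 2) * 2 ^ n"
  shows "\<exists>S\<subseteq>{..<n}. real (card (down_link n G S)) \<ge> x ^ 3"
proof -
  let ?V = "Pow {..<n}"
  define D where "D A = {i \<in> A. {vec n A, vec n (A - {i})} \<in> edges G}" for A
  define T where "T A = {(c, x, y). distinct [c, x, y] \<and> {c, x, y} \<subseteq> D A}" for A
  have finD: "finite (D A)" if "A \<in> ?V" for A
    using that by (auto simp: D_def intro: finite_subset)
  \<comment> \<open>Each edge is charged to its upper end A, as a down-edge in some direction of
    \<open>D A\<close>.\<close>
  have "edges G \<subseteq> (\<lambda>(A, i). {vec n A, vec n (A - {i})}) ` (SIGMA A:?V. D A)"
  proof
    fix e assume e: "e \<in> edges G"
    then have "e \<in> edges (hypercube n)" using G by (auto simp: subgraph_def)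
    then obtain p q i where pq: "e = {p, q}" "differ_at n i p q" by (auto simp: edges_hypercube)
    then obtain A B where AB: "A \<subseteq> {..<n}" "B \<subseteq> {..<n}" "p = vec n A" "q = vec n B"
      using vec_surj[of p n] vec_surj[of q n] unfolding differ_at_def by metis
    have i: "i < n" using pq(2) by (simp add: differ_at_def)
    have mem: "(j \<in> A) \<noteq> (j \<in> B) \<longleftrightarrow> j = i" for j
      using differ_at_nth[OF pq(2), of j] AB i by (cases "j < n") auto
    show "e \<in> (\<lambda>(A, i). {vec n A, vec n (A - {i})}) ` (SIGMA A:?V. D A)"
    proof (cases "i \<in> A")
      case True
      have "j \<in> B \<longleftrightarrow> j \<in> A - {i}" for j using mem[of j] True by auto
      then have "B = A - {i}" by blast
      then have "e = {vec n A, vec n (A - {i})}" using pq AB by simp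
      moreover from this have "i \<in> D A" using e True by (simp add: D_def)
      ultimately have "(A, i) \<in> (SIGMA A:?V. D A)" "e = (\<lambda>(A, i). {vec n A, vec n (A - {i})}) (A, i)"
        using AB(1,2) by simp_all
      then show ?thesis by (rule rev_image_eqI)
    next
      case False
      have "j \<in> A \<longleftrightarrow> j \<in> B - {i}" for j using mem[of j] False by auto
      then have B: "i \<in> B" "A = B - {i}" using mem[of i] False by auto
      then have "e = {vec n B, vec n (B - {i})}" using pq AB by (simp add: insert_commute)
      moreover from this have "i \<in> D B" using e B by (simp add: D_def)
      ultimately have "(B, i) \<in> (SIGMA A:?V. D A)" "e = (\<lambda>(A, i). {vec n A, vec n (A - {i})}) (B, i)"
        using AB(1,2) by simp_all
      then show ?thesis by (rule rev_image_eqI)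
    qed
  qed
  moreover have "finite (SIGMA A:?V. D A)" using finD by (intro finite_SigmaI) auto
  ultimately have "card (edges G) \<le> card (SIGMA A:?V. D A)" by (rule surj_card_le[rotated])
  also have "\<dots> = (\<Sum>A\<in>?V. card (D A))" using finD by (intro card_SigmaI) auto
  finally have "(x + 2) * 2 ^ n \<le> (\<Sum>A\<in>?V. real (card (D A)))"
    using dense by (simp flip: of_nat_sum)
  then have sumD: "x * 2 ^ n \<le> (\<Sum>A\<in>?V. real (card (D A)) - 2)"
    by (simp add: sum_subtractf card_Pow algebra_simps)
  \<comment> \<open>The tangent at x takes the value x^3 at x, and the mean of
    \<open>card (D A) - 2\<close> is at least x.\<close>
  have "x ^ 3 * 2 ^ n = 3 * x\<^sup>2 * (x * 2 ^ n) - 2 * x ^ 3 * 2 ^ n" by algebra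
  also have "\<dots> \<le> 3 * x\<^sup>2 * (\<Sum>A\<in>?V. real (card (D A)) - 2) - 2 * x ^ 3 * 2 ^ n"
    using mult_left_mono[OF sumD, of "3 * x\<^sup>2"] by simp
  also have "\<dots> = (\<Sum>A\<in>?V. 3 * x\<^sup>2 * (real (card (D A)) - 2) - 2 * x ^ 3)"
    unfolding sum_subtractf[of "\<lambda>A. 3 * x\<^sup>2 * (real (card (D A)) - 2)"] sum_distrib_left by (simp add: card_Pow)
  also have "\<dots> \<le> (\<Sum>A\<in>?V. real (card (T A)))"
    using falling_cube_tangent[OF x] finD
    by (intro sum_mono) (simp only: T_def card_distinct_triples)
  also have "\<dots> = real (card (SIGMA A:?V. T A))"
  proof -
    have "finite (T A)" if "A \<in> ?V" for A
      by (rule finite_subset[of _ "D A \<times> D A \<times> D A"]) (use finD[OF that] in \<open>auto simp: T_def\<close>)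
    then show ?thesis by (simp add: card_SigmaI)
  qed
  also have "\<dots> \<le> real (card (SIGMA S:?V. down_link n G S))"
  proof -
    \<comment> \<open>No information is lost, since A is recovered as the union of its base and the
      triple.\<close>
    define h where "h = (\<lambda>(A :: nat set, c, x, y). (A - {c, x, y :: nat}, c, x, y))"
    have "inj_on h (SIGMA A:?V. T A)"
      by (rule inj_onI) (auto simp: h_def T_def D_def)
    moreover have "h ` (SIGMA A:?V. T A) \<subseteq> (SIGMA S:?V. down_link n G S)"
    proof (rule image_subsetI)
      fix z assume "z \<in> (SIGMA A:?V. T A)"
      then obtain A c x y where z: "z = (A, c, x, y)" and A: "A \<subseteq> {..<n}" "(c, x, y) \<in> T A" by auto
      then have T: "distinct [c, x, y]" "{c, x, y} \<subseteq> A" "{vec n A, vec n (A - {c})} \<in> edges G"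
        "{vec n A, vec n (A - {x})} \<in> edges G" "{vec n A, vec n (A - {y})} \<in> edges G"
        by (simp_all add: T_def D_def)
      then have base: "(A - {c, x, y}) \<union> {c, x, y} = A" "(A - {c, x, y}) \<union> {x, y} = A - {c}"
        "(A - {c, x, y}) \<union> {c, y} = A - {x}" "(A - {c, x, y}) \<union> {c, x} = A - {y}"
        by auto
      have "{c, x, y} \<subseteq> {..<n} - (A - {c, x, y})" using A(1) T(2) by blast
      with T have "(c, x, y) \<in> down_link n G (A - {c, x, y})"
        unfolding down_link_def mem_Collect_eq prod.case base by blast
      moreover have "A - {c, x, y} \<subseteq> {..<n}" using A(1) by blast
      ultimately show "h z \<in> (SIGMA S:?V. down_link n G S)" by (simp add: z h_def)
    qed
    moreover have "finite (SIGMA S:?V. down_link n G S)"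
      by (rule finite_subset[of _ "?V \<times> {..<n} \<times> {..<n} \<times> {..<n}"]) (auto simp: down_link_def)
    ultimately show ?thesis by (intro of_nat_mono card_inj_on_le)
  qed
  also have "\<dots> = (\<Sum>S\<in>?V. real (card (down_link n G S)))"
  proof -
    have "finite (down_link n G S)" for S
      by (rule finite_subset[of _ "{..<n} \<times> {..<n} \<times> {..<n}"]) (auto simp: down_link_def)
    then show ?thesis by (simp add: card_SigmaI)
  qed
  finally have "x ^ 3 * card ?V \<le> (\<Sum>S\<in>?V. real (card (down_link n G S)))" by (simp add: card_Pow)
  from exists_ge_average[OF _ _ this] show ?thesis by auto
qed

lemma sym_down_link_Image: "sym (down_link n G S `` {c})"
  by (auto simp: sym_def down_link_def insert_commute)

lemma lollipop_bound:
  assumes G: "subgraph G (hypercube n)" and n: "n > 0" and s: "s \<ge> 2"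
    and free: "is_free (cycle_graph (4 * s)) G \<or> is_free (cycle_graph (4 * s + 6)) G"
  shows "real (card (edges G)) < real ((2 * s + 1)\<^sup>2 + s + 3) * (real n powr (11 / 12) * 2 ^ n)"
proof (rule ccontr)
  define C where "C = real ((2 * s + 1)\<^sup>2 + s)"
  define y where "y = real n powr (11 / 12)"
  define w where "w = sqrt (real n)"
  \<comment> \<open>The surplus 1 in C + 1 absorbs the diagonal term n^3 of
    \<open>dense_common_link\<close>, and the further 2 in C + 3 the summand 2 of
    \<open>dense_down_link\<close>.\<close>
  define x where "x = (C + 1) * y"
  have C: "C \<ge> 1" 
  proof -
    have "real 1 \<le> real ((2 * s + 1)\<^sup>2 + s)" using s by (intro of_nat_mono) linarith
    then show ?thesis by (simp add: C_def)
  qed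
  have y: "y \<ge> 1" using n by (simp add: y_def ge_one_powr_ge_zero)
  have w: "w \<ge> 1" "w\<^sup>2 = real n" using n by (auto simp: w_def)
  \<comment> \<open>The exponent 11/12 is chosen so that y^6 / n^4 = n * w, which is
    n^(3/2).\<close>
  have y6: "y ^ 6 = real n ^ 5 * w"
  proof -
    have "y ^ 6 = real n powr (11 / 2)" using n by (simp add: y_def powr_powr flip: powr_realpow)
    also have "\<dots> = real n powr 5 * real n powr (1 / 2)" using powr_add[of "real n" 5 "1 / 2"] by simp
    also have "\<dots> = real n ^ 5 * w" using n by (simp add: w_def powr_half_sqrt)
    finally show ?thesis .
  qed
  assume "\<not> ?thesis"
  then have "real (card (edges G)) \<ge> (C + 3) * (y * 2 ^ n)" by (simp add: C_def y_def)
  also have "(C + 3) * (y * 2 ^ n) = (x + 2 * y) * 2 ^ n" by (simp add: x_def algebra_simps)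
  finally have "(x + 2 * y) * 2 ^ n \<le> real (card (edges G))" .
  moreover have "(x + 2) * 2 ^ n \<le> (x + 2 * y) * 2 ^ n" using y by (intro mult_right_mono) auto
  ultimately have "(x + 2) * 2 ^ n \<le> real (card (edges G))" by linarith
  moreover have x: "x \<ge> 0" using C y by (simp add: x_def)
  ultimately obtain S where S: "S \<subseteq> {..<n}" "real (card (down_link n G S)) \<ge> x ^ 3"
    using dense_down_link[OF G] by blast
  define R where "R = down_link n G S"
  have K: "(C + 1) ^ 6 \<ge> C + 1" using C by (intro self_le_power) auto
  have x6: "(x ^ 3)\<^sup>2 = (C + 1) ^ 6 * (real n ^ 5 * w)"
    by (simp add: x_def power_mult_distrib y6[symmetric] flip: power_mult)
  have pos: "real n ^ 5 * w > 0" using n w by simp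
  have x6_ge: "(C + 1) * (real n ^ 5 * w) \<le> (x ^ 3)\<^sup>2"
    unfolding x6 using K pos by (intro mult_right_mono) auto
  have nw: "real n ^ 5 \<le> real n ^ 5 * w" using w n by simp
  have big: "(x ^ 3)\<^sup>2 > real (card ({..<n} \<times> {..<n})) ^ 2 * card {..<n}"
  proof -
    have "real (card ({..<n} \<times> {..<n})) ^ 2 * card {..<n} = real n ^ 5"
      by (simp add: card_cartesian_product power2_eq_square numeral_eq_Suc)
    also have "\<dots> \<le> real n ^ 5 * w" by (rule nw)
    also have "\<dots> = 1 * (real n ^ 5 * w)" by simp
    also have "\<dots> < (C + 1) * (real n ^ 5 * w)" using C by (intro mult_strict_right_mono pos) auto
    also have "\<dots> \<le> (x ^ 3)\<^sup>2" by (rule x6_ge)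
    finally show ?thesis .
  qed
  have R: "R \<subseteq> {..<n} \<times> {..<n} \<times> {..<n}" by (auto simp: R_def down_link_def)
  from dense_common_link[OF _ _ R _ _ big] S(2) x obtain c c' where c: "c \<noteq> c'" and
    L_ge: "real (card (R `` {c} \<inter> R `` {c'})) \<ge> ((x ^ 3)\<^sup>2 / card ({..<n} \<times> {..<n})
        - real (card {..<n}) * card ({..<n} \<times> {..<n})) / real (card {..<n}) ^ 2"
    by (auto simp: R_def)
  define L where "L = R `` {c} \<inter> R `` {c'}"
  have "C * (real n * w) \<le> real (card L)"
  proof -
    have "C * (real n * w) = ((C + 1) * (real n ^ 5 * w) - real n ^ 5 * w) / real n ^ 4"
      using n by (simp add: field_simps numeral_eq_Suc)
    also have "\<dots> \<le> ((x ^ 3)\<^sup>2 - real n ^ 5) / real n ^ 4"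
    proof (rule divide_right_mono)
      show "(C + 1) * (real n ^ 5 * w) - real n ^ 5 * w \<le> (x ^ 3)\<^sup>2 - real n ^ 5"
        using x6_ge nw by linarith
    qed simp
    also have "\<dots> = ((x ^ 3)\<^sup>2 / real n ^ 2 - real n ^ 3) / real n ^ 2"
      using n by (simp add: field_simps numeral_eq_Suc)
    also have "\<dots> \<le> real (card L)"
      using L_ge by (simp add: L_def card_cartesian_product power2_eq_square power3_eq_cube mult.assoc)
    finally show ?thesis .
  qed
  then have "(C * (real n * w))\<^sup>2 \<le> (real (card L))\<^sup>2"
    using C w by (intro power_mono) auto
  moreover have "C * real n ^ 3 \<le> (C * (real n * w))\<^sup>2"
  proof -
    have "(C * (real n * w))\<^sup>2 = C\<^sup>2 * real n ^ 3" unfolding power_mult_distrib w(2) by (simp add: power2_eq_square power3_eq_cube)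
    moreover have "C \<le> C\<^sup>2" using C by (simp add: power2_eq_square)
    ultimately show ?thesis by (simp add: mult_right_mono)
  qed
  ultimately have "C * real (card {..<n}) ^ 3 \<le> (real (card L))\<^sup>2" by simp
  moreover have "sym L" unfolding L_def R_def by (intro sym_Int sym_down_link_Image)
  moreover have "L \<subseteq> {..<n} \<times> {..<n}" using R by (auto simp: L_def)
  moreover have "{..<n} \<noteq> {}" using n by auto
  ultimately obtain u where u: "inj_on u {..2 * s}" "\<forall>j<2 * s. (u j, u (Suc j)) \<in> L" "(u (2 * s), u 1) \<in> L"
    using dense_lollipop[of "{..<n}" L s] s by (auto simp: C_def)
  have "simple_graph G" using G by (simp add: subgraph_def)
  from not_free_if_lollipop[OF this S(1) s c u(1)] u(2,3) free show False
    by (auto simp: L_def R_def)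
qed

lemma cycle_free_hypercube_density:
  assumes k: "k \<ge> 4" "k \<noteq> 5"
  shows "\<exists>K>0. \<forall>n>0. \<forall>G. subgraph G (hypercube n) \<longrightarrow> is_free (cycle_graph (2 * k)) G \<longrightarrow>
    real (card (edges G)) \<le> K * real n powr (- 1 / 12) * (real n * 2 ^ n)"
proof -
  \<comment> \<open>An odd k equals 2s + 3, and s \<ge> 2 then means k \<ge> 7. For k = 5 one would
    need s = 1, a degenerate cycle of length 2.\<close>
  have "\<exists>s\<ge>2. 2 * k = 4 * s \<or> 2 * k = 4 * s + 6"
  proof (cases "even k")
    case True
    then show ?thesis using k by (intro exI[of _ "k div 2"]) auto
  next
    case False
    then obtain j where "k = 2 * j + 1" by (elim oddE)
    then show ?thesis using k by (intro exI[of _ "j - 1"]) auto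
  qed
  then obtain s where s: "s \<ge> 2" "2 * k = 4 * s \<or> 2 * k = 4 * s + 6" by blast
  define K where "K = real ((2 * s + 1)\<^sup>2 + s + 3)"
  have "real (card (edges G)) \<le> K * real n powr (- 1 / 12) * (real n * 2 ^ n)"
    if G: "n > 0" "subgraph G (hypercube n)" "is_free (cycle_graph (2 * k)) G" for n G
  proof -
    have "real n powr (11 / 12) = real n powr (- 1 / 12) * real n"
      using powr_add[of "real n" "- 1 / 12" 1] G(1) by simp
    then show ?thesis using lollipop_bound[OF G(2,1) s(1)] s(2) G(3) by (auto simp: K_def mult.assoc)
  qed
  moreover have "K > 0" unfolding K_def of_nat_0_less_iff by simp
  ultimately show ?thesis by blast
qed

section \<open>Counting and packing cycles in the hypercube\<close>

text \<open>If step i were the only one to flip p, the walk onward from its end around the cycle to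
  its start would preserve coordinate p, so step i could not flip it.\<close>

lemma card_flip_coords_cycle:
  assumes C: "C \<in> copies (hypercube n) (cycle_graph m)" and m: "m \<ge> 3"
  shows "2 * card (flip_coord ` edges C) \<le> m"
proof -
  obtain f where f: "inj_on f {..<m}" "C = cyc f m"
    "\<forall>i<m. f i \<in> verts (hypercube n) \<and> {f i, f (Suc i mod m)} \<in> edges (hypercube n)"
    using C by (rule copies_cycleE)
  define c where "c i = flip_coord {f i, f (Suc i mod m)}" for i
  have c: "differ_at n (c i) (f i) (f (Suc i mod m))" if i: "i < m" for i
  proof -
    from f(3) i obtain p where "differ_at n p (f i) (f (Suc i mod m))"
      by (auto simp: doubleton_in_hypercube)
    then show ?thesis using flip_coord_eq c_def by simp
  qed
  define J where "J = c ` {..<m}"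
  have J: "flip_coord ` edges C = J" by (auto simp: f(2) cyc_def J_def c_def)
  have "2 \<le> card {i \<in> {..<m}. c i = p}" if p: "p \<in> J" for p
  proof -
    from p obtain i where i: "i < m" "p = c i" by (auto simp: J_def)
    have pn: "p < n" using c[OF i(1)] i(2) by (simp add: differ_at_def)
    have "\<exists>i'<m. i' \<noteq> i \<and> c i' = p"
    proof (rule ccontr)
      assume none: "\<not> ?thesis"
      have const: "f i' ! p = f (Suc i' mod m) ! p" if "i' < m" "i' \<noteq> i" for i'
        using differ_at_nth[OF c[OF that(1)] pn] none that by auto
      have "t < m \<Longrightarrow> f ((Suc i + t) mod m) ! p = f (Suc i mod m) ! p" for t
      proof (induction t)
        case (Suc t)
        have "(Suc i + t) mod m \<noteq> i"
          using Suc.prems i(1) le_mod_geq[of m "Suc i + t"] by (cases "Suc i + t < m") auto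
        then have "f ((Suc i + t) mod m) ! p = f (Suc ((Suc i + t) mod m) mod m) ! p"
          using m by (intro const) auto
        then show ?case using Suc by (simp add: mod_Suc_eq)
      qed simp
      from this[of "m - 1"] have "f i ! p = f (Suc i mod m) ! p" using i(1) m by simp
      then show False using differ_at_nth[OF c[OF i(1)] pn] i(2) by simp
    qed
    then obtain i' where "i' < m" "i' \<noteq> i" "c i' = p" by blast
    then have "{i, i'} \<subseteq> {i \<in> {..<m}. c i = p}" "card {i, i'} = 2" using i by auto
    then show ?thesis using card_mono[of "{i \<in> {..<m}. c i = p}" "{i, i'}"] by simp
  qed
  then have "(\<Sum>p\<in>J. 2) \<le> (\<Sum>p\<in>J. card {i \<in> {..<m}. c i = p})" by (intro sum_mono)
  also have "\<dots> = m"
    using sum.group[of "{..<m}" J c "\<lambda>_. 1::nat"] by (simp add: J_def)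
  finally show ?thesis by (simp add: J mult.commute)
qed

text \<open>A cycle with flip coordinates \<open>J\<close> is determined by its constant coordinates outside \<open>J\<close>
  and its projection to \<open>J\<close>.\<close>

lemma card_cycles_flip_coords:
  assumes J: "J \<subseteq> {..<n}" and m: "m \<ge> 3"
  shows "card {C \<in> copies (hypercube n) (cycle_graph m). flip_coord ` edges C = J}
    \<le> 2 ^ (n - card J) *
      card {C \<in> copies (hypercube (card J)) (cycle_graph m). flip_coord ` edges C = {..<card J}}"
proof -
  define j where "j = card J"
  have finJ: "finite J" using J by (rule finite_subset) simp
  define p q where "p = sorted_list_of_set J" and "q = sorted_list_of_set ({..<n} - J)"
  have p: "set p = J" "distinct p" "length p = j" using finJ by (auto simp: p_def j_def)
  have q: "set q = {..<n} - J" "length q = n - j"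
    using finJ J by (auto simp: q_def j_def card_Diff_subset)
  define pr co :: "bool list \<Rightarrow> bool list" where "pr x = map ((!) x) p" and "co x = map ((!) x) q" for x
  \<comment> \<open>A slice is one of the subcubes with directions J; there \<open>pr\<close> is
    injective and renumbers the coordinates in J from 0 in increasing order.\<close>
  define slice where "slice w = {x. length x = n \<and> co x = w}" for w
  have pr_inj: "inj_on pr (slice w)" for w
  proof (rule inj_onI)
    fix x y assume xy: "x \<in> slice w" "y \<in> slice w" "pr x = pr y"
    have "x ! k = y ! k" if "k < n" for k
    proof (cases "k \<in> J")
      case True
      then show ?thesis using xy(3) p(1) by (auto simp: pr_def)
    next
      case False
      have "co x = co y" using xy by (simp add: slice_def)
      then show ?thesis using q(1) False that by (auto simp: co_def)
    qed
    then show "x = y" using xy by (auto simp: slice_def intro: nth_equalityI)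
  qed
  let ?A = "{C \<in> copies (hypercube n) (cycle_graph m). flip_coord ` edges C = J}"
  let ?Z = "{C \<in> copies (hypercube j) (cycle_graph m). flip_coord ` edges C = {..<j}}"
  \<comment> \<open>The constant value of \<open>co\<close> is recorded as the set of its values on
    C, a singleton, so that no vertex of C has to be chosen.\<close>
  define \<Psi> where "\<Psi> C = (co ` verts C, (pr ` verts C, (`) pr ` edges C))" for C :: "bool list graph"
  have main: "\<exists>w. length w = n - j \<and> co ` verts C = {w} \<and> verts C \<subseteq> slice w \<and> edges C \<subseteq> Pow (slice w) \<and>
      (pr ` verts C, (`) pr ` edges C) \<in> ?Z" if C: "C \<in> ?A" for C
  proof -
    obtain f where f: "inj_on f {..<m}" "C = cyc f m"
      "\<forall>i<m. f i \<in> verts (hypercube n) \<and> {f i, f (Suc i mod m)} \<in> edges (hypercube n)"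
      using C by (auto elim: copies_cycleE)
    have step: "\<exists>i\<in>J. differ_at n i (f a) (f (Suc a mod m)) \<and> flip_coord {f a, f (Suc a mod m)} = i" if a: "a < m" for a
    proof -
      from f(3) a obtain i where i: "differ_at n i (f a) (f (Suc a mod m))"
        by (auto simp: doubleton_in_hypercube)
      moreover have "flip_coord {f a, f (Suc a mod m)} \<in> J"
        using C a unfolding f(2) by (auto simp: cyc_def)
      ultimately show ?thesis using flip_coord_eq by auto
    qed
    have co_step: "co (f a) = co (f (Suc a mod m))" if a: "a < m" for a
    proof -
      from step[OF a] obtain i where "i \<in> J" "differ_at n i (f a) (f (Suc a mod m))" by blast
      then show ?thesis using q(1) differ_at_nth[of n i "f a"] by (auto simp: co_def)
    qed
    define w where "w = co (f 0)"
    have co: "a < m \<Longrightarrow> co (f a) = w" for a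
    proof (induction a)
      case (Suc a)
      then show ?case using co_step[of a] by simp
    qed (simp add: w_def)
    have len: "length (f a) = n" if "a < m" for a using f(3) that by (simp add: verts_hypercube)
    have sl: "f a \<in> slice w" if "a < m" for a using co[OF that] len[OF that] by (simp add: slice_def)
    have "co x = w" if "x \<in> verts C" for x using that co by (auto simp: f(2) cyc_def)
    moreover have "f 0 \<in> verts C" using m by (simp add: f(2) cyc_def)
    ultimately have 1: "co ` verts C = {w}" by blast
    have 2: "verts C \<subseteq> slice w" using sl by (auto simp: f(2) cyc_def)
    have 3: "edges C \<subseteq> Pow (slice w)" using sl Suc_mod_less by (auto simp: f(2) cyc_def)
    have proj: "differ_at j a (pr x) (pr y)" if xy: "differ_at n (p ! a) x y" and a: "a < j" for x y a
    proof -
      have "pr x ! b \<noteq> pr y ! b \<longleftrightarrow> b = a" if b: "b < j" for b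
      proof -
        have "p ! b < n" using J p b by (metis lessThan_iff nth_mem subsetD)
        then have "x ! (p ! b) \<noteq> y ! (p ! b) \<longleftrightarrow> p ! b = p ! a" using differ_at_nth[OF xy] by blast
        then show ?thesis using p a b by (simp add: pr_def nth_eq_iff_index_eq)
      qed
      then show ?thesis using a p(3) by (simp add: differ_at_def pr_def)
    qed
    have step': "\<exists>a<j. p ! a = flip_coord {f i, f (Suc i mod m)} \<and> differ_at j a (pr (f i)) (pr (f (Suc i mod m)))"
      if "i < m" for i
    proof -
      from step[OF that] obtain k where k: "k \<in> J" "differ_at n k (f i) (f (Suc i mod m))"
        "flip_coord {f i, f (Suc i mod m)} = k" by blast
      then obtain a where "a < j" "p ! a = k" using p by (metis in_set_conv_nth)
      then show ?thesis using proj k by auto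
    qed
    have eq: "(pr ` verts C, (`) pr ` edges C) = cyc (pr \<circ> f) m"
      by (auto simp: f(2) cyc_def image_image)
    have 4: "cyc (pr \<circ> f) m \<in> copies (hypercube j) (cycle_graph m)"
    proof (rule cyc_in_copies[OF _ m simple_hypercube])
      show "inj_on (pr \<circ> f) {..<m}"
        using f(1) sl by (intro comp_inj_on inj_on_subset[OF pr_inj]) auto
      show "{(pr \<circ> f) i, (pr \<circ> f) (Suc i mod m)} \<in> edges (hypercube j)" if "i < m" for i
        using step'[OF that] by (auto simp: doubleton_in_hypercube)
    qed
    have "flip_coord ` edges (cyc (pr \<circ> f) m) = {..<j}"
    proof (intro equalityI subsetI)
      fix a assume "a \<in> flip_coord ` edges (cyc (pr \<circ> f) m)"
      then obtain e where "e \<in> edges (cyc (pr \<circ> f) m)" "a = flip_coord e" by blast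
      moreover have "e \<in> edges (hypercube j)" using 4 calculation(1) by (auto simp: copies_def subgraph_def)
      ultimately show "a \<in> {..<j}" using flip_coord_less by auto
    next
      fix a assume "a \<in> {..<j}"
      then have a: "a < j" by simp
      then have "p ! a \<in> flip_coord ` edges C" using C p by (metis (mono_tags, lifting) mem_Collect_eq nth_mem)
      then obtain i where i: "i < m" "flip_coord {f i, f (Suc i mod m)} = p ! a"
        by (auto simp: f(2) cyc_def)
      from step'[OF i(1)] obtain b where b: "b < j" "p ! b = p ! a" "differ_at j b (pr (f i)) (pr (f (Suc i mod m)))"
        using i(2) by auto
      then have "b = a" using p a by (simp add: nth_eq_iff_index_eq)
      then have "a = flip_coord {(pr \<circ> f) i, (pr \<circ> f) (Suc i mod m)}" using flip_coord_eq b(3) by simp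
      then show "a \<in> flip_coord ` edges (cyc (pr \<circ> f) m)" using i(1) unfolding cyc_def by auto
    qed
    then have "(pr ` verts C, (`) pr ` edges C) \<in> ?Z" using 4 unfolding eq by simp
    moreover have "length w = n - j" using q by (simp add: w_def co_def)
    ultimately show ?thesis using 1 2 3 by blast
  qed
  have "inj_on \<Psi> ?A"
  proof (rule inj_onI)
    fix C C' assume C: "C \<in> ?A" "C' \<in> ?A" "\<Psi> C = \<Psi> C'"
    from main[OF C(1)] obtain w where w: "co ` verts C = {w}" "verts C \<subseteq> slice w" "edges C \<subseteq> Pow (slice w)" by blast
    from main[OF C(2)] obtain w' where w': "co ` verts C' = {w'}" "verts C' \<subseteq> slice w'" "edges C' \<subseteq> Pow (slice w')" by blast
    have "w = w'" using C(3) w(1) w'(1) by (simp add: \<Psi>_def)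
    then have "verts C = verts C'"
      using C(3) w w' inj_on_image_eq_iff[OF pr_inj] by (simp add: \<Psi>_def)
    moreover have "edges C = edges C'"
      using C(3) w w' \<open>w = w'\<close> inj_on_image_eq_iff[OF inj_on_image_Pow[OF pr_inj]] by (simp add: \<Psi>_def)
    ultimately show "C = C'" by (simp add: prod_eq_iff)
  qed
  moreover have "\<Psi> ` ?A \<subseteq> (\<lambda>w. {w}) ` {w. length w = n - j} \<times> ?Z"
  proof (rule image_subsetI)
    fix C assume "C \<in> ?A"
    from main[OF this] show "\<Psi> C \<in> (\<lambda>w. {w}) ` {w. length w = n - j} \<times> ?Z"
      unfolding \<Psi>_def by blast
  qed
  moreover have finZ: "finite ?Z"
    using finite_copies[OF finite_verts_hypercube finite_edges_hypercube, of j "cycle_graph m"]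
    by (rule finite_subset[rotated]) auto
  ultimately have "card ?A \<le> card ((\<lambda>w. {w}) ` {w :: bool list. length w = n - j} \<times> ?Z)"
    using finite_bool_lists by (intro card_inj_on_le) auto
  also have "\<dots> = 2 ^ (n - j) * card ?Z"
    by (simp add: card_cartesian_product card_image card_bool_lists)
  finally show ?thesis by (simp add: j_def)
qed

text \<open>Copies are sorted by their set of flip coordinates. An upper bound is what is called
  for, since the number of copies is the denominator of the ratio to be bounded below.\<close>

lemma num_copies_cycle_le:
  assumes l: "l \<ge> 2"
  shows "num_copies (hypercube n) (cycle_graph (2 * l)) \<le> (\<Sum>j\<le>l. (n choose j) * (2 ^ (n - j) * full_cycles j l))"
proof -
  let ?fib = "\<lambda>J. {C \<in> copies (hypercube n) (cycle_graph (2 * l)). flip_coord ` edges C = J}"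
  let ?S = "\<lambda>j. {J. J \<subseteq> {..<n} \<and> card J = j}"
  have finS: "finite (?S j)" for j by simp
  have fin: "finite (copies (hypercube n) (cycle_graph (2 * l)))"
    by (intro finite_copies finite_verts_hypercube finite_edges_hypercube)
  have "copies (hypercube n) (cycle_graph (2 * l)) \<subseteq> (\<Union>j\<le>l. \<Union>J\<in>?S j. ?fib J)"
  proof
    fix C assume C: "C \<in> copies (hypercube n) (cycle_graph (2 * l))"
    have "flip_coord ` edges C \<subseteq> {..<n}"
      using C flip_coord_less by (fastforce simp: copies_def subgraph_def)
    moreover have "card (flip_coord ` edges C) \<le> l" using card_flip_coords_cycle[OF C] l by simp
    ultimately show "C \<in> (\<Union>j\<le>l. \<Union>J\<in>?S j. ?fib J)" using C by blast
  qed
  then have "num_copies (hypercube n) (cycle_graph (2 * l)) \<le> card (\<Union>j\<le>l. \<Union>J\<in>?S j. ?fib J)"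
    unfolding num_copies_def using finS fin
    by (intro card_mono) auto
  also have "\<dots> \<le> (\<Sum>j\<le>l. \<Sum>J\<in>?S j. card (?fib J))"
    using finS by (intro order_trans[OF card_UN_le] sum_mono card_UN_le) auto
  also have "\<dots> \<le> (\<Sum>j\<le>l. \<Sum>J\<in>?S j. 2 ^ (n - j) * full_cycles j l)"
    using card_cycles_flip_coords l by (intro sum_mono) (auto simp: full_cycles_def)
  also have "\<dots> = (\<Sum>j\<le>l. (n choose j) * (2 ^ (n - j) * full_cycles j l))"
    by (simp add: n_subsets)
  finally show ?thesis .
qed

section \<open>Even cycles in the hypercube from Gray codes\<close>

primrec gray :: "nat \<Rightarrow> bool list list" where
  "gray 0 = [[]]"
| "gray (Suc n) = map (Cons False) (gray n) @ rev (map (Cons True) (gray n))"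

lemma length_gray [simp]: "length (gray n) = 2 ^ n"
  by (induction n) auto

lemma set_gray: "set (gray n) \<subseteq> {x. length x = n}"
  by (induction n) auto

lemma distinct_gray: "distinct (gray n)"
  by (induction n) (auto simp: distinct_map)

definition hypercube_adj :: "nat \<Rightarrow> bool list \<Rightarrow> bool list \<Rightarrow> bool" where
  "hypercube_adj n x y \<longleftrightarrow> (\<exists>i. differ_at n i x y)"

lemma hypercube_adj_commute: "hypercube_adj n x y \<longleftrightarrow> hypercube_adj n y x"
  by (auto simp: hypercube_adj_def differ_at_commute)

lemma hypercube_adj_append:
  assumes "hypercube_adj n x y" shows "hypercube_adj (length w + n) (w @ x) (w @ y)"
proof -
  from assms obtain i where "differ_at n i x y" by (auto simp: hypercube_adj_def)
  then have "differ_at (length w + n) (length w + i) (w @ x) (w @ y)"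
    by (auto simp: differ_at_def nth_append)
  then show ?thesis by (auto simp: hypercube_adj_def)
qed

lemma hypercube_adj_Cons: "hypercube_adj n x y \<Longrightarrow> hypercube_adj (Suc n) (b # x) (b # y)"
  using hypercube_adj_append[of n x y "[b]"] by simp

lemma hypercube_adj_flip: "length x = n \<Longrightarrow> hypercube_adj (Suc n) (False # x) (True # x)"
  unfolding hypercube_adj_def differ_at_def by (intro exI[of _ 0]) (auto simp: nth_Cons')

lemma successively_reflected:
  assumes "successively (hypercube_adj n) xs" "set xs \<subseteq> {x. length x = n}"
  shows "successively (hypercube_adj (Suc n)) (map (Cons False) xs @ rev (map (Cons True) xs))"
proof -
  have "successively (\<lambda>x y. hypercube_adj (Suc n) (b # x) (b # y)) xs" for b
    using assms(1) by (rule successively_mono) (simp add: hypercube_adj_Cons)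
  moreover have "successively (\<lambda>x y. hypercube_adj (Suc n) (b # y) (b # x)) xs" for b
    using assms(1) by (rule successively_mono) (simp add: hypercube_adj_Cons hypercube_adj_commute)
  moreover have "hypercube_adj (Suc n) (False # last xs) (True # last xs)" if "xs \<noteq> []"
    using assms(2) that by (intro hypercube_adj_flip) (auto dest: last_in_set)
  ultimately show ?thesis
    by (cases "xs = []") (simp_all add: successively_append_iff successively_map last_map hd_rev)
qed

lemma successively_gray: "successively (hypercube_adj n) (gray n)"
  by (induction n) (use successively_reflected set_gray in auto)

text \<open>An initial segment of length l of the Hamiltonian path \<open>gray m\<close> is placed
  in two opposite facets and traversed there in opposite directions, so both ends match up. It is
  the reflection step of the Gray code applied to a truncated list.\<close>

lemma hypercube_even_cycle:
  assumes l: "0 < l" "l \<le> 2 ^ m"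
  obtains xs where "length xs = 2 * l" "distinct xs" "set xs \<subseteq> {x. length x = Suc m}"
    "successively (hypercube_adj (Suc m)) xs" "hypercube_adj (Suc m) (last xs) (hd xs)"
proof
  define ys where "ys = take l (gray m)"
  let ?xs = "map (Cons False) ys @ rev (map (Cons True) ys)"
  have len: "length ys = l" using l by (simp add: ys_def)
  have set: "set ys \<subseteq> {x. length x = m}" using set_gray set_take_subset unfolding ys_def by fast
  have dist: "distinct ys" using distinct_gray by (simp add: ys_def)
  have "successively (hypercube_adj m) (ys @ drop l (gray m))" using successively_gray by (simp add: ys_def)
  then have succ: "successively (hypercube_adj m) ys" by (simp only: successively_append_iff)
  have ne: "ys \<noteq> []" using len l by auto
  show "length ?xs = 2 * l" using len by simp
  show "distinct ?xs" using dist by (auto simp: distinct_map)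
  show "set ?xs \<subseteq> {x. length x = Suc m}" using set by auto
  show "successively (hypercube_adj (Suc m)) ?xs" using succ set by (rule successively_reflected)
  have "hypercube_adj (Suc m) (False # hd ys) (True # hd ys)"
    using set ne by (intro hypercube_adj_flip) (auto dest: hd_in_set)
  then show "hypercube_adj (Suc m) (last ?xs) (hd ?xs)"
    using ne hypercube_adj_commute by (simp add: last_rev hd_append hd_map)
qed

section \<open>Vertex-disjoint unions of cycles\<close>

lemma Suc_mod_surj:
  assumes "i < m" obtains i' where "i' < m" "Suc i' mod m = i"
proof (cases i)
  case 0
  then show ?thesis using assms that[of "m - 1"] by auto
next
  case (Suc j)
  then show ?thesis using assms that[of j] by auto
qed

lemma Suc_mod_inj: "i < m \<Longrightarrow> j < m \<Longrightarrow> Suc i mod m = Suc j mod m \<Longrightarrow> i = j"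
  by (cases "Suc i = m"; cases "Suc j = m") auto

text \<open>A p-cycle in the union stays inside one component, so p \<le> m. It uses two distinct
  neighbours at each of its vertices, and a component offers only two; hence it contains the
  successor of each of its vertices, so the whole component, and m \<le> p.\<close>

lemma disjoint_cycles_free:
  fixes F :: "'w \<Rightarrow> nat \<Rightarrow> 'a"
  assumes inj: "inj_on (\<lambda>(w, i). F w i) (W \<times> {..<m})" and m: "m \<ge> 3" and p: "p \<ge> 3" "p \<noteq> m"
  shows "is_free (cycle_graph p) (\<Union>w\<in>W. verts (cyc (F w) m), \<Union>w\<in>W. edges (cyc (F w) m))"
    (is "is_free _ ?G")
  unfolding is_free_def
proof (rule equals0I)
  fix S assume "S \<in> copies ?G (cycle_graph p)"
  then obtain f where f: "inj_on f {..<p}" and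
    fG: "\<forall>j<p. f j \<in> verts ?G \<and> {f j, f (Suc j mod p)} \<in> edges ?G" by (rule copies_cycleE)
  have F_eq: "F w i = F w' i' \<longleftrightarrow> w = w' \<and> i = i'" if "w \<in> W" "w' \<in> W" "i < m" "i' < m" for w w' i i'
    using inj_onD[OF inj, of "(w, i)" "(w', i')"] that by auto
  have nbr: "(y = F w (Suc i mod m)) \<or> (\<exists>i'<m. Suc i' mod m = i \<and> y = F w i')"
    if w: "w \<in> W" "i < m" and e: "{F w i, y} \<in> edges ?G" for w i y
  proof -
    from e obtain w' i' where w': "w' \<in> W" "i' < m" "{F w i, y} = {F w' i', F w' (Suc i' mod m)}"
      by (auto simp: cyc_def)
    have "F w i = F w' i' \<and> y = F w' (Suc i' mod m) \<or> F w i = F w' (Suc i' mod m) \<and> y = F w' i'"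
      using w'(3) by (auto simp: doubleton_eq_iff)
    then show ?thesis using F_eq[OF w(1) w'(1) w(2)] w'(2) Suc_mod_less[OF w'(2)] by auto
  qed
  have "f 0 \<in> verts ?G" using fG p by simp
  then obtain w i0 where w: "w \<in> W" and i0: "i0 < m" "f 0 = F w i0" by (auto simp: cyc_def)
  have in_w: "j < p \<Longrightarrow> f j \<in> F w ` {..<m}" for j
  proof (induction j)
    case (Suc j)
    then obtain i where i: "i < m" "f j = F w i" by auto
    have "{F w i, f (Suc j)} \<in> edges ?G" using fG Suc.prems i(2) by (metis Suc_lessD mod_less)
    from nbr[OF w i(1) this] show ?case using Suc_mod_less[OF i(1)] by auto
  qed (use i0 in auto)
  then have "f ` {..<p} \<subseteq> F w ` {..<m}" by auto
  then have "card (f ` {..<p}) \<le> card (F w ` {..<m})" by (intro card_mono) auto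
  then have "p \<le> m" using f card_image_le[of "{..<m}" "F w"] by (simp add: card_image)
  have next_in: "F w (Suc i mod m) \<in> f ` {..<p}" if i: "i < m" "F w i \<in> f ` {..<p}" for i
  proof -
    from i(2) obtain j where j: "j < p" "f j = F w i" by auto
    \<comment> \<open>j' and k are the two neighbours of j on the p-cycle, distinct because p \<ge>
      3. If neither leads to the successor of i, both lead to its unique predecessor.\<close>
    obtain j' where j': "j' < p" "Suc j' mod p = j" using Suc_mod_surj[OF j(1)] .
    define k where "k = Suc j mod p"
    have k: "k < p" using Suc_mod_less[OF j(1)] by (simp add: k_def)
    have "k \<noteq> j'"
    proof
      assume "k = j'"
      then have "Suc (Suc j mod p) mod p = j" using j' by (simp add: k_def)
      then show False using j(1) p(1) by (cases "Suc j = p"; cases "Suc (Suc j) = p") auto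
    qed
    then have ne: "f k \<noteq> f j'" using f k j'(1) by (auto simp: inj_on_def)
    have "{F w i, f k} \<in> edges ?G" using fG j by (metis k_def)
    moreover have "{f j', f (Suc j' mod p)} \<in> edges ?G" using fG j'(1) by blast
    then have "{F w i, f j'} \<in> edges ?G" by (simp only: j'(2) j(2) insert_commute)
    ultimately have nbrs: "f k = F w (Suc i mod m) \<or> (\<exists>i'<m. Suc i' mod m = i \<and> f k = F w i')"
      "f j' = F w (Suc i mod m) \<or> (\<exists>i'<m. Suc i' mod m = i \<and> f j' = F w i')"
      by (intro nbr[OF w i(1)]; simp)+
    show ?thesis
    proof (rule ccontr)
      assume "\<not> ?thesis"
      then have "f k \<noteq> F w (Suc i mod m)" "f j' \<noteq> F w (Suc i mod m)"
        using k j'(1) by (metis imageI lessThan_iff)+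
      then obtain i1 i2 where *: "i1 < m" "Suc i1 mod m = i" "f k = F w i1"
          "i2 < m" "Suc i2 mod m = i" "f j' = F w i2"
        using nbrs by fast
      have "i1 = i2" by (rule Suc_mod_inj[OF *(1,4)]) (simp only: *(2,5))
      then show False using *(3,6) ne by simp
    qed
  qed
  have all_in: "F w ((i0 + t) mod m) \<in> f ` {..<p}" for t
  proof (induction t)
    case 0
    then show ?case using i0 p by (auto simp: image_iff intro!: bexI[of _ 0])
  next
    case (Suc t)
    have "F w (Suc ((i0 + t) mod m) mod m) \<in> f ` {..<p}" by (rule next_in) (use Suc m in auto)
    then show ?case by (simp add: mod_Suc_eq)
  qed
  have "F w ` {..<m} \<subseteq> f ` {..<p}"
  proof (rule image_subsetI)
    fix i assume i: "i \<in> {..<m}"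
    have "(i0 + (m - i0 + i)) mod m = i" using i i0(1) by simp
    then show "F w i \<in> f ` {..<p}" using all_in[of "m - i0 + i"] by simp
  qed
  then have "card (F w ` {..<m}) \<le> card (f ` {..<p})" by (intro card_mono) auto
  moreover have "inj_on (F w) {..<m}" using F_eq w by (auto simp: inj_on_def)
  ultimately have "m \<le> p" using card_image_le[of "{..<p}" f] by (simp add: card_image)
  with \<open>p \<le> m\<close> p(2) show False by simp
qed

text \<open>The first n - (m + 1) bits w select a subcube, and the same cycle is placed in each. All
  prefixes have the same length, so cycles with different prefixes are disjoint.\<close>

lemma disjoint_cycles_in_hypercube:
  assumes l: "2 \<le> l" "l \<le> 2 ^ m" and n: "Suc m \<le> n" and k: "k \<ge> 2" "k \<noteq> l"
  obtains G where "subgraph G (hypercube n)" "is_free (cycle_graph (2 * k)) G"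
    "2 ^ (n - Suc m) \<le> num_copies G (cycle_graph (2 * l))"
proof -
  obtain xs where xs: "length xs = 2 * l" "distinct xs" "set xs \<subseteq> {x. length x = Suc m}"
    "successively (hypercube_adj (Suc m)) xs" "hypercube_adj (Suc m) (last xs) (hd xs)"
    using hypercube_even_cycle[of l m] l by auto
  define W where "W = {w :: bool list. length w = n - Suc m}"
  define F where "F w = (!) (map ((@) w) xs)" for w
  define G where "G = (\<Union>w\<in>W. verts (cyc (F w) (2 * l)), \<Union>w\<in>W. edges (cyc (F w) (2 * l)))"
  have copy: "cyc (F w) (2 * l) \<in> copies (hypercube n) (cycle_graph (2 * l))" if w: "w \<in> W" for w
  proof -
    have adj: "{w @ x, w @ y} \<in> edges (hypercube n)" if "hypercube_adj (Suc m) x y" for x y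
      using hypercube_adj_append[OF that, of w] w n
      by (simp add: W_def hypercube_adj_def doubleton_in_hypercube)
    have "xs \<noteq> []" using xs(1) l by auto
    then have "{last (map ((@) w) xs), hd (map ((@) w) xs)} \<in> edges (hypercube n)"
      using adj xs(5) by (simp add: last_map hd_map)
    moreover have "successively (\<lambda>x y. {x, y} \<in> edges (hypercube n)) (map ((@) w) xs)"
      unfolding successively_map using xs(4) by (rule successively_mono) (simp add: adj)
    moreover have "distinct (map ((@) w) xs)" using xs(2) by (simp add: distinct_map inj_on_def)
    ultimately show ?thesis
      using cyc_nth_in_copies[of "map ((@) w) xs" "hypercube n"] simple_hypercube xs(1) l
      by (simp add: F_def)
  qed
  have F: "F w i = w @ xs ! i" if "i < 2 * l" for w i using that xs(1) by (simp add: F_def)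
  have sub: "subgraph G (hypercube n)"
    unfolding subgraph_def
  proof (intro conjI)
    have simp: "simple_graph (cyc (F w) (2 * l))" if "w \<in> W" for w
      using copy[OF that] by (simp add: copies_def subgraph_def)
    show "simple_graph G"
      unfolding simple_graph_def
    proof
      fix e assume "e \<in> edges G"
      then obtain w where w: "w \<in> W" "e \<in> edges (cyc (F w) (2 * l))" by (auto simp: G_def)
      then obtain u v where uv: "u \<in> verts (cyc (F w) (2 * l))" "v \<in> verts (cyc (F w) (2 * l))" "u \<noteq> v" "e = {u, v}"
        using simp[OF w(1)] unfolding simple_graph_def by blast
      then have "u \<in> verts G" "v \<in> verts G" using w(1) unfolding G_def by auto
      then show "\<exists>u v. u \<in> verts G \<and> v \<in> verts G \<and> u \<noteq> v \<and> e = {u, v}" using uv by blast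
    qed
    show "verts G \<subseteq> verts (hypercube n)" "edges G \<subseteq> edges (hypercube n)"
      using copy by (auto simp: G_def copies_def subgraph_def)
  qed
  have inj: "inj_on (\<lambda>(w, i). F w i) (W \<times> {..<2 * l})"
  proof (rule inj_onI, clarify)
    fix w i w' i' assume *: "w \<in> W" "w' \<in> W" "i < 2 * l" "i' < 2 * l" "F w i = F w' i'"
    then have "w @ xs ! i = w' @ xs ! i'" by (simp add: F)
    then have "w = w'" "xs ! i = xs ! i'" using * by (auto simp: W_def)
    then show "w = w' \<and> i = i'" using xs(1,2) * by (simp add: nth_eq_iff_index_eq)
  qed
  have free: "is_free (cycle_graph (2 * k)) G"
    unfolding G_def using l k by (intro disjoint_cycles_free[OF inj]) auto
  have "card W \<le> card (copies G (cycle_graph (2 * l)))"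
  proof (rule card_inj_on_le[where f = "\<lambda>w. cyc (F w) (2 * l)"])
    show "inj_on (\<lambda>w. cyc (F w) (2 * l)) W"
    proof (rule inj_onI)
      fix w w' assume w: "w \<in> W" "w' \<in> W" "cyc (F w) (2 * l) = cyc (F w') (2 * l)"
      have "F w 0 \<in> F w' ` {..<2 * l}" using w(3) l by (auto simp: cyc_def)
      then obtain i where "i < 2 * l" "F w 0 = F w' i" by auto
      then show "w = w'" using inj_onD[OF inj, of "(w, 0)" "(w', i)"] w(1,2) l by auto
    qed
    show "(\<lambda>w. cyc (F w) (2 * l)) ` W \<subseteq> copies G (cycle_graph (2 * l))"
    proof (rule image_subsetI)
      fix w assume w: "w \<in> W"
      then have "verts (cyc (F w) (2 * l)) \<subseteq> verts G" "edges (cyc (F w) (2 * l)) \<subseteq> edges G"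
        unfolding G_def by auto
      then show "cyc (F w) (2 * l) \<in> copies G (cycle_graph (2 * l))"
        using copy[OF w] by (simp add: copies_def subgraph_def)
    qed
    have "finite (copies (hypercube n) (cycle_graph (2 * l)))"
      by (intro finite_copies finite_verts_hypercube finite_edges_hypercube)
    then show "finite (copies G (cycle_graph (2 * l)))"
      by (rule finite_subset[OF copies_mono[OF sub]])
  qed
  then have "2 ^ (n - Suc m) \<le> num_copies G (cycle_graph (2 * l))"
    by (simp add: W_def card_bool_lists num_copies_def)
  with sub free show thesis by (rule that)
qed

section \<open>The bounds\<close>

text \<open>The numerator is at most n^(l-1) and the denominator at least (n/l)^l, so the ratio is
  at most l^l / n.\<close>

lemma binomial_ratio_tendsto_0:
  assumes "j < l"
  shows "(\<lambda>n. real (n choose j) / real (n choose l)) \<longlonglongrightarrow> 0"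
proof (rule tendsto_sandwich[of "\<lambda>_. 0" _ _ "\<lambda>n. real l ^ l / real n"])
  show "\<forall>\<^sub>F n in sequentially. real (n choose j) / real (n choose l) \<le> real l ^ l / real n"
    using eventually_ge_at_top[of "Suc l"]
  proof eventually_elim
    case (elim n)
    have n: "real n > 0" "real l > 0" using elim assms by auto
    have "n choose j \<le> n ^ j" using assms elim by (intro binomial_le_pow) simp
    also have "\<dots> \<le> n ^ (l - 1)" using assms elim by (intro power_increasing) auto
    finally have "real (n choose j) \<le> real n ^ (l - 1)" by (metis of_nat_le_iff of_nat_power)
    moreover have "(real n / real l) ^ l \<le> real (n choose l)"
      using elim by (intro binomial_ge_n_over_k_pow_k) simp
    ultimately have "real (n choose j) / real (n choose l) \<le> real n ^ (l - 1) / (real n / real l) ^ l"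
      using n by (intro frac_le) auto
    also have "\<dots> = real l ^ l * (real n ^ (l - 1) / real n ^ l)" by (simp add: power_divide)
    also have "real n ^ (l - 1) / real n ^ l = 1 / real n"
      using n assms by (cases l) auto
    finally show ?case by simp
  qed
  show "(\<lambda>n. real l ^ l / real n) \<longlonglongrightarrow> 0" by (rule lim_const_over_n)
qed auto

text \<open>The o(1) of the theorem: the terms j < l of \<open>num_copies_cycle_le\<close> divided
  by the term j = l. By \<open>x / 0 = 0\<close> it vanishes where that leading term does.\<close>

definition lower_order_ratio :: "nat \<Rightarrow> nat \<Rightarrow> real" where
  "lower_order_ratio l n =
     (\<Sum>j<l. 2 ^ (l - j) * real (full_cycles j l) / real (full_cycles l l) * (real (n choose j) / real (n choose l)))"

lemma lower_order_ratio_nonneg: "lower_order_ratio l n \<ge> 0"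
  by (auto simp: lower_order_ratio_def intro!: sum_nonneg)

lemma lower_order_ratio_tendsto_0: "lower_order_ratio l \<longlonglongrightarrow> 0"
  unfolding lower_order_ratio_def
  by (intro tendsto_null_sum tendsto_mult_right_zero binomial_ratio_tendsto_0) auto

lemma num_copies_cycle_le_leading_term:
  assumes l: "2 \<le> l" "l \<le> n" and z: "full_cycles l l > 0"
  shows "real (num_copies (hypercube n) (cycle_graph (2 * l)))
    \<le> 2 ^ (n - l) * (real (n choose l) * real (full_cycles l l)) * (1 + lower_order_ratio l n)"
proof -
  define X where "X = real (n choose l) * real (full_cycles l l)"
  have X: "X > 0" using l z by (simp add: X_def)
  have summand: "real ((n choose j) * (2 ^ (n - j) * full_cycles j l)) =
      2 ^ (n - l) * X * (2 ^ (l - j) * real (full_cycles j l) / real (full_cycles l l)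
        * (real (n choose j) / real (n choose l)))" if "j < l" for j
  proof -
    have "n - j = (n - l) + (l - j)" using l that by simp
    then have "(2 :: real) ^ (n - j) = 2 ^ (n - l) * 2 ^ (l - j)" by (simp add: power_add)
    then show ?thesis using l z by (simp add: X_def field_simps)
  qed
  have "real (num_copies (hypercube n) (cycle_graph (2 * l)))
      \<le> (\<Sum>j\<le>l. real ((n choose j) * (2 ^ (n - j) * full_cycles j l)))"
    using of_nat_mono[OF num_copies_cycle_le[OF l(1), of n]] by (simp only: of_nat_sum)
  also have "\<dots> = (\<Sum>j<l. real ((n choose j) * (2 ^ (n - j) * full_cycles j l))) + 2 ^ (n - l) * X"
    by (simp add: lessThan_Suc_atMost[symmetric] X_def)
  also have "\<dots> = 2 ^ (n - l) * X * (1 + lower_order_ratio l n)"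
    unfolding lower_order_ratio_def by (simp add: summand sum_distrib_left distrib_left del: of_nat_mult)
  finally show ?thesis by (simp add: X_def)
qed

lemma turan_ratio_cycle_ge:
  assumes l: "2 \<le> l" "l \<noteq> k" and k: "k \<ge> 2"
  shows "inverse (real (n choose l)) *
      (2 powi (int l - \<lceil>log 2 (2 * real l)\<rceil>) / real (full_cycles l l)) * (1 - lower_order_ratio l n)
    \<le> turan_ratio (hypercube n) (cycle_graph (2 * l)) (cycle_graph (2 * k))"
    (is "?L \<le> ?R")
proof (cases "l \<le> n \<and> full_cycles l l > 0")
  case False
  \<comment> \<open>For n < l the binomial coefficient is 0, and inverting or dividing by 0 gives 0,
    so the left side vanishes in both degenerate cases.\<close>
  then have "?L = 0" by (cases "l \<le> n") (auto simp: binomial_eq_0)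
  moreover have "?R \<ge> 0" by (simp add: turan_ratio_def)
  ultimately show ?thesis by (simp only:)
next
  case True
  define c where "c = \<lceil>log 2 (2 * real l)\<rceil>"
  have c1: "c \<ge> 1"
  proof -
    have "log 2 (2 * real l) > 0" using l by simp
    then show ?thesis by (simp add: c_def)
  qed
  \<comment> \<open>The subcubes have dimension \<open>Suc m\<close> = c; their cycles are built
    from paths of l vertices in dimension m, which requires l \<le> 2^m.\<close>
  define m where "m = nat (c - 1)"
  have cm: "c = int (Suc m)" using c1 by (simp add: m_def)
  have "real l \<le> 2 ^ m"
  proof -
    have "log 2 (2 * real l) \<le> of_int c" by (simp only: c_def le_of_int_ceiling)
    then have "log 2 (2 * real l) \<le> real (Suc m)" by (simp only: cm of_int_of_nat_eq)
    then have "2 * real l \<le> 2 powr real (Suc m)" using l by (subst (asm) log_le_iff) auto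
    then have "2 * real l \<le> 2 ^ Suc m" by (simp only: powr_realpow zero_less_numeral)
    then show ?thesis by simp
  qed
  then have lm: "l \<le> 2 ^ m" by (metis of_nat_le_iff of_nat_numeral of_nat_power)
  \<comment> \<open>From 2l \<le> 2^l: the subcubes fit into the hypercube because l \<le> n, and
    the exponent of \<open>powi\<close> is nonnegative.\<close>
  have ml: "Suc m \<le> l"
  proof -
    have "2 * l \<le> 2 ^ l"
    proof -
      obtain j where j: "l = Suc j" using l by (cases l) auto
      have "Suc j \<le> 2 ^ j" by (intro Suc_leI less_exp)
      then show ?thesis by (simp add: j)
    qed
    then have "2 * real l \<le> 2 powr real l"
      by (simp add: powr_realpow) (metis of_nat_le_iff of_nat_mult of_nat_numeral of_nat_power)
    then have "log 2 (2 * real l) \<le> real l" using l by (subst log_le_iff) auto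
    then have "c \<le> int l" by (simp add: c_def ceiling_le_iff)
    then show ?thesis using cm by simp
  qed
  obtain G where G: "subgraph G (hypercube n)" "is_free (cycle_graph (2 * k)) G"
    "2 ^ (n - Suc m) \<le> num_copies G (cycle_graph (2 * l))"
    using disjoint_cycles_in_hypercube[OF l(1) lm, of n k] ml True k l by auto
  let ?N = "real (num_copies (hypercube n) (cycle_graph (2 * l)))"
  define X where "X = real (n choose l) * real (full_cycles l l)"
  define r where "r = lower_order_ratio l n"
  have X: "X > 0" using True by (simp add: X_def)
  have r: "r \<ge> 0" using lower_order_ratio_nonneg by (simp add: r_def)
  have "num_copies G (cycle_graph (2 * l)) \<le> gen_turan (hypercube n) (cycle_graph (2 * l)) (cycle_graph (2 * k))"
    by (rule num_copies_le_gen_turan[OF finite_verts_hypercube finite_edges_hypercube G(1,2)])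
  with G(3) have "2 ^ (n - Suc m) \<le> gen_turan (hypercube n) (cycle_graph (2 * l)) (cycle_graph (2 * k))"
    by (rule order_trans)
  then have turan: "2 ^ (n - Suc m) \<le> real (gen_turan (hypercube n) (cycle_graph (2 * l)) (cycle_graph (2 * k)))"
    by (metis of_nat_le_iff of_nat_numeral of_nat_power)
  have "num_copies G (cycle_graph (2 * l)) \<le> num_copies (hypercube n) (cycle_graph (2 * l))"
    unfolding num_copies_def
    by (intro card_mono finite_copies finite_verts_hypercube finite_edges_hypercube copies_mono G(1))
  moreover have "0 < (2 :: nat) ^ (n - Suc m)" by simp
  ultimately have N: "?N > 0" using G(3) by linarith
  have "?L = 2 ^ (l - Suc m) * (1 - r) / X"
  proof -
    have "int l - c = int (l - Suc m)" using cm ml by (simp add: of_nat_diff)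
    then have "2 powi (int l - c) = (2 :: real) ^ (l - Suc m)" by simp
    then show ?thesis by (simp add: c_def[symmetric] r_def X_def divide_simps)
  qed
  \<comment> \<open>The inequality 1 - r \<le> 1 / (1 + r) turns the relative error of the
    denominator into the factor 1 - o(1).\<close>
  also have "\<dots> \<le> 2 ^ (l - Suc m) * (1 / (1 + r)) / X"
  proof -
    have "(1 - r) * (1 + r) \<le> 1" by (simp add: algebra_simps)
    then have "1 - r \<le> 1 / (1 + r)" using r by (simp add: le_divide_eq)
    then show ?thesis using X by (intro divide_right_mono mult_left_mono) auto
  qed
  also have "\<dots> = 2 ^ (n - Suc m) / (2 ^ (n - l) * X * (1 + r))"
  proof -
    have "n - Suc m = (n - l) + (l - Suc m)" using ml True by simp
    then have "(2 :: real) ^ (n - Suc m) = 2 ^ (n - l) * 2 ^ (l - Suc m)" by (simp add: power_add)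
    then show ?thesis by (simp add: mult_ac)
  qed
  also have "\<dots> \<le> 2 ^ (n - Suc m) / ?N"
    using num_copies_cycle_le_leading_term[of l n] l True N
    by (intro divide_left_mono) (auto simp: X_def r_def)
  also have "\<dots> \<le> ?R"
    unfolding turan_ratio_def using turan N by (intro divide_right_mono) auto
  finally show ?thesis .
qed

theorem theorem7:
  fixes k :: nat
  assumes "k \<ge> 4" and "k \<noteq> 5"
  shows "\<exists>c::real. c > 0 \<and>
    (\<forall>l::nat. 2 \<le> l \<and> l \<noteq> k \<longrightarrow>
      (\<exists>\<epsilon> :: nat \<Rightarrow> real. (\<forall>n. \<epsilon> n \<ge> 0) \<and> \<epsilon> \<longlonglongrightarrow> 0 \<and>
        (\<forall>n::nat. k \<le> 2 ^ n \<and> l \<le> 2 ^ n \<longrightarrow>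
          inverse (real (n choose l)) *
            (2 powi (int l - \<lceil>log 2 (2 * real l)\<rceil>) / real (full_cycles l l)) * (1 - \<epsilon> n)
              \<le> turan_ratio (hypercube n) (cycle_graph (2 * l)) (cycle_graph (2 * k)) \<and>
          turan_ratio (hypercube n) (cycle_graph (2 * l)) (cycle_graph (2 * k))
              \<le> c * real n powr (- 1 / 16))))"
proof -
  from cycle_free_hypercube_density[OF assms] obtain K where K: "K > 0"
    and bound: "\<And>n G. n > 0 \<Longrightarrow> subgraph G (hypercube n) \<Longrightarrow> is_free (cycle_graph (2 * k)) G \<Longrightarrow>
      real (card (edges G)) \<le> K * real n powr (- 1 / 12) * (real n * 2 ^ n)" by blast
  have upper: "turan_ratio (hypercube n) (cycle_graph (2 * l)) (cycle_graph (2 * k))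
      \<le> 2 * K * real n powr (- 1 / 16)" if l: "2 \<le> l" and n: "k \<le> 2 ^ n" for l n
  proof -
    \<comment> \<open>At n = 0 the right side would be 0, as \<open>0 powr _\<close> is 0; this case
      is excluded by 4 \<le> k \<le> 2^n.\<close>
    have n: "n > 0" using n assms(1) by (cases n) auto
    have "turan_ratio (hypercube n) (cycle_graph (2 * l)) (cycle_graph (2 * k))
        \<le> 2 * (K * real n powr (- 1 / 12))"
      using l assms(1) n K bound by (intro turan_ratio_hypercube_le) auto
    also have "\<dots> \<le> 2 * (K * real n powr (- 1 / 16))"
      using K n by (intro mult_left_mono powr_mono) auto
    finally show ?thesis by (simp add: mult.assoc)
  qed
  \<comment> \<open>The constant has to be fixed before l; K depends on k alone, because it comes
    from the edge density, in which l does not occur.\<close>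
  show ?thesis
  proof (intro exI[of _ "2 * K"] conjI allI impI)
    fix l :: nat assume l: "2 \<le> l \<and> l \<noteq> k"
    show "\<exists>\<epsilon> :: nat \<Rightarrow> real. (\<forall>n. \<epsilon> n \<ge> 0) \<and> \<epsilon> \<longlonglongrightarrow> 0 \<and>
        (\<forall>n::nat. k \<le> 2 ^ n \<and> l \<le> 2 ^ n \<longrightarrow>
          inverse (real (n choose l)) *
            (2 powi (int l - \<lceil>log 2 (2 * real l)\<rceil>) / real (full_cycles l l)) * (1 - \<epsilon> n)
              \<le> turan_ratio (hypercube n) (cycle_graph (2 * l)) (cycle_graph (2 * k)) \<and>
          turan_ratio (hypercube n) (cycle_graph (2 * l)) (cycle_graph (2 * k))
              \<le> 2 * K * real n powr (- 1 / 16))"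
      using l assms(1) lower_order_ratio_nonneg lower_order_ratio_tendsto_0 upper turan_ratio_cycle_ge[of l k]
      by (intro exI[of _ "lower_order_ratio l"]) auto
  qed (use K in simp)
qed

end
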